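(* Suppose that $\boldsymbol{W}\in\mathbb{DQ}^{n \times n}$ is unitary, partitioned as $$\boldsymbol{W}=\begin{pmatrix}\boldsymbol{W}_{11}&\boldsymbol{W}_{12}\\ \boldsymbol{W}_{21}&\boldsymbol{W}_{22}\end{pmatrix},$$ where $\boldsymbol{W}_{11}\in \mathbb{DQ}^{r_1\times t_1}$, $\boldsymbol{W}_{12}\in \mathbb{DQ}^{r_1\times t_2}$, $\boldsymbol{W}_{21}\in \mathbb{DQ}^{r_2\times t_1}$, $\boldsymbol{W}_{22}\in \mathbb{DQ}^{r_2\times t_2}$. Then there exist unitary matrices $\boldsymbol{U}_{1}\in \mathbb{DQ}^{r_{1} \times r_{1}}$, $\boldsymbol{U}_{2}\in \mathbb{DQ}^{r_{2} \times r_{2}}$, $\boldsymbol{V}_{1}\in \mathbb{DQ}^{t_{1} \times t_{1}}$, $\boldsymbol{V}_{2}\in \mathbb{DQ}^{t_{2} \times t_{2}}$ such that $$\begin{pmatrix}\boldsymbol{U}_{1}^*&0\\ 0&\boldsymbol{U}_{2}^*\end{pmatrix}\boldsymbol{W}\begin{pmatrix}\boldsymbol{V}_{1}&0\\ 0&\boldsymbol{V}_{2}\end{pmatrix}=\begin{pmatrix}D_{11}&D_{12}\\ D_{21}&D_{22}\end{pmatrix}=\left(\begin{array}{ccccc|ccccc} I&&&&&\Sigma\epsilon&&&&\\ &I&&&&&0&&&\\ &&C&&&&&S&&\\ &&&D\epsilon&&&&&I&\\ &&&&0&&&&&I\\ \hline \Sigma\epsilon&&&&&-I&&&&\\ &0&&&&&-I&&&\\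 &&S&&&&&-C&&\\ &&&I&&&&&-D\epsilon&\\ &&&&I&&&&&0 \end{array}\right),$$ where blank entries are zero, $I$ denotes identity matrices of suitable sizes, $\Sigma$ and $D$ are real diagonal matrices, $C$ and $S$ are diagonal matrices with appreciable dual number entries, and $$\Sigma=\mathrm{diag}(\sigma_1,\dots,\sigma_r),\ \sigma_1\ge\cdots\ge\sigma_r>0;\qquad D=\mathrm{diag}(d_1,\dots,d_t),\ d_1\ge\cdots\ge d_t>0;$$ $$C=\mathrm{diag}(c_1,\dots,c_l),\ 1>c_1\ge\cdots\ge c_l>0;\qquad S=\mathrm{diag}(s_1,\dots,s_l),\ 0<s_1\le\cdots\le s_l<1;\qquad C^2+S^2=I_l,$$ for some nonnegative integers $r,t,l$.
   Context: Dual numbers: $\mathbb{D}=\{a+b\epsilon: a,b\in\mathbb{R}\}$ with $\epsilon\neq0$, $\epsilon^2=0$; $a+b\epsilon$ is appreciable if $a\ne0$ and infinitesimal otherwise. $\mathbb{D}$ is totally ordered lexicographically: $a+b\epsilon>a'+b'\epsilon$ iff $a>a'$, or $a=a'$ and $b>b'$. $\mathbb{Q}$ denotes the real (Hamilton) quaternions, and $\mathbb{DQ}=\{\mathbf{q}_{st}+\mathbf{q}_{in}\epsilon:\mathbf{q}_{st},\mathbf{q}_{in}\in\mathbb{Q}\}$ the dual quaternions, where $\epsilon$ commutes with quaternions; conjugation is $\mathbf{q}_{st}^*+\mathbf{q}_{in}^*\epsilon$. For a matrix $\boldsymbol{A}$ over $\mathbb{DQ}$, $\boldsymbol{A}^*$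 is its conjugate transpose. A square $\boldsymbol{U}$ is unitary if $\boldsymbol{U}^*\boldsymbol{U}=\boldsymbol{U}\boldsymbol{U}^*=I$. Zero blocks may be rectangular, and blocks with zero rows or columns are allowed (empty). *)

theory Defs
  imports "Jordan_Normal_Form.Matrix"
begin

section \<open>Dual numbers over a ring\<close>

text \<open>\<open>Dual a b\<close> is $a + b\epsilon$. Over the reals these are the dual numbers, over the
  quaternions the dual quaternions.\<close>

codatatype 'a dual = Dual (std_part: 'a) (inf_part: 'a)

lemma dual_eq_iff: "x = y \<longleftrightarrow> std_part x = std_part y \<and> inf_part x = inf_part y"
  by (auto intro: dual.expand)

instantiation dual :: (ring_1) ring_1
begin

primcorec zero_dual :: "'a dual" where
  "std_part 0 = 0" | "inf_part 0 = 0"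

primcorec one_dual :: "'a dual" where
  "std_part 1 = 1" | "inf_part 1 = 0"

primcorec plus_dual :: "'a dual \<Rightarrow> 'a dual \<Rightarrow> 'a dual" where
  "std_part (x + y) = std_part x + std_part y"
| "inf_part (x + y) = inf_part x + inf_part y"

primcorec minus_dual :: "'a dual \<Rightarrow> 'a dual \<Rightarrow> 'a dual" where
  "std_part (x - y) = std_part x - std_part y"
| "inf_part (x - y) = inf_part x - inf_part y"

primcorec uminus_dual :: "'a dual \<Rightarrow> 'a dual" where
  "std_part (- x) = - std_part x"
| "inf_part (- x) = - inf_part x"

primcorec times_dual :: "'a dual \<Rightarrow> 'a dual \<Rightarrow> 'a dual" where
  "std_part (x * y) = std_part x * std_part y"
| "inf_part (x * y) = std_part x * inf_part y + inf_part x * std_part y"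

instance
  by standard (auto simp: dual_eq_iff algebra_simps)

end

instance dual :: (comm_ring_1) comm_ring_1
  by standard (auto simp: dual_eq_iff algebra_simps)

instantiation dual :: (linorder) linorder
begin

text \<open>The order is lexicographic.\<close>

definition less_dual :: "'a dual \<Rightarrow> 'a dual \<Rightarrow> bool" where
  "x < y \<longleftrightarrow> std_part x < std_part y \<or> std_part x = std_part y \<and> inf_part x < inf_part y"

definition less_eq_dual :: "'a dual \<Rightarrow> 'a dual \<Rightarrow> bool" where
  "x \<le> y \<longleftrightarrow> x < y \<or> x = (y :: 'a dual)"

instance
  by standard (auto simp: less_dual_def less_eq_dual_def dual_eq_iff)

end

definition appreciable :: "'a::zero dual \<Rightarrow> bool" where
  "appreciable x \<longleftrightarrow> std_part x \<noteq> 0"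


section \<open>Quaternions and dual quaternions\<close>

codatatype quat = Quat (QRe: real) (QIm1: real) (QIm2: real) (QIm3: real)

lemma quat_eq_iff:
  "x = y \<longleftrightarrow> QRe x = QRe y \<and> QIm1 x = QIm1 y \<and> QIm2 x = QIm2 y \<and> QIm3 x = QIm3 y"
  by (auto intro: quat.expand)

instantiation quat :: real_algebra_1
begin

primcorec zero_quat :: quat where
  "QRe 0 = 0" | "QIm1 0 = 0" | "QIm2 0 = 0" | "QIm3 0 = 0"

primcorec one_quat :: quat where
  "QRe 1 = 1" | "QIm1 1 = 0" | "QIm2 1 = 0" | "QIm3 1 = 0"

primcorec plus_quat :: "quat \<Rightarrow> quat \<Rightarrow> quat" where
  "QRe (x + y) = QRe x + QRe y"
| "QIm1 (x + y) = QIm1 x + QIm1 y"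
| "QIm2 (x + y) = QIm2 x + QIm2 y"
| "QIm3 (x + y) = QIm3 x + QIm3 y"

primcorec minus_quat :: "quat \<Rightarrow> quat \<Rightarrow> quat" where
  "QRe (x - y) = QRe x - QRe y"
| "QIm1 (x - y) = QIm1 x - QIm1 y"
| "QIm2 (x - y) = QIm2 x - QIm2 y"
| "QIm3 (x - y) = QIm3 x - QIm3 y"

primcorec uminus_quat :: "quat \<Rightarrow> quat" where
  "QRe (- x) = - QRe x"
| "QIm1 (- x) = - QIm1 x"
| "QIm2 (- x) = - QIm2 x"
| "QIm3 (- x) = - QIm3 x"

primcorec times_quat :: "quat \<Rightarrow> quat \<Rightarrow> quat" where
  "QRe (x * y) = QRe x * QRe y - QIm1 x * QIm1 y - QIm2 x * QIm2 y - QIm3 x * QIm3 y"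
| "QIm1 (x * y) = QRe x * QIm1 y + QIm1 x * QRe y + QIm2 x * QIm3 y - QIm3 x * QIm2 y"
| "QIm2 (x * y) = QRe x * QIm2 y - QIm1 x * QIm3 y + QIm2 x * QRe y + QIm3 x * QIm1 y"
| "QIm3 (x * y) = QRe x * QIm3 y + QIm1 x * QIm2 y - QIm2 x * QIm1 y + QIm3 x * QRe y"

primcorec scaleR_quat :: "real \<Rightarrow> quat \<Rightarrow> quat" where
  "QRe (scaleR a x) = a * QRe x"
| "QIm1 (scaleR a x) = a * QIm1 x"
| "QIm2 (scaleR a x) = a * QIm2 x"
| "QIm3 (scaleR a x) = a * QIm3 x"

instance
  by standard (auto simp: quat_eq_iff algebra_simps)

end

primcorec qcnj :: "quat \<Rightarrow> quat" where
  "QRe (qcnj x) = QRe x"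
| "QIm1 (qcnj x) = - QIm1 x"
| "QIm2 (qcnj x) = - QIm2 x"
| "QIm3 (qcnj x) = - QIm3 x"

type_synonym dual_quat = "quat dual"

abbreviation dq_cnj :: "dual_quat \<Rightarrow> dual_quat" where
  "dq_cnj \<equiv> map_dual qcnj"

abbreviation dq_of_dual :: "real dual \<Rightarrow> dual_quat" where
  "dq_of_dual \<equiv> map_dual of_real"


section \<open>Matrices of dual quaternions\<close>

definition dq_adjoint :: "dual_quat mat \<Rightarrow> dual_quat mat" where
  "dq_adjoint A = transpose_mat (map_mat dq_cnj A)"

definition dq_unitary :: "dual_quat mat \<Rightarrow> bool" where
  "dq_unitary U \<longleftrightarrow> square_mat U \<and>
     dq_adjoint U * U = 1\<^sub>m (dim_row U) \<and> U * dq_adjoint U = 1\<^sub>m (dim_row U)"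

definition dq_diag :: "nat \<Rightarrow> (nat \<Rightarrow> real dual) \<Rightarrow> dual_quat mat" where
  "dq_diag k f = mat_diag k (\<lambda>i. dq_of_dual (f i))"

text \<open>\<open>dq_diag_eps k f\<close> is $\mathrm{diag}(f_0,\dots,f_{k-1})\epsilon$ for real $f_i$.\<close>

definition dq_diag_eps :: "nat \<Rightarrow> (nat \<Rightarrow> real) \<Rightarrow> dual_quat mat" where
  "dq_diag_eps k f = dq_diag k (\<lambda>i. Dual 0 (f i))"

definition block_diag2 :: "dual_quat mat \<Rightarrow> dual_quat mat \<Rightarrow> dual_quat mat" where
  "block_diag2 A B =
     four_block_mat A (0\<^sub>m (dim_row A) (dim_col B)) (0\<^sub>m (dim_row B) (dim_col A)) B"

end

theory Submission
  imports Defs "HOL-Analysis.Function_Topology"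
begin

text \<open>
  The first block column of a unitary \<open>W\<close> determines the decomposition. Its blocks satisfy
  \<open>W\<^sub>1\<^sub>1\<^sup>*W\<^sub>1\<^sub>1 + W\<^sub>2\<^sub>1\<^sup>*W\<^sub>2\<^sub>1 = I\<close>, so a unitary \<open>V\<close> that diagonalises the Hermitian matrix
  \<open>W\<^sub>1\<^sub>1\<^sup>*W\<^sub>1\<^sub>1\<close> makes the columns of both \<open>M = W\<^sub>1\<^sub>1V\<close> and \<open>N = W\<^sub>2\<^sub>1V\<close> orthogonal, with squared norms
  \<open>f\<^sub>i\<close> and \<open>1 - f\<^sub>i\<close>. A squared norm with standard part \<open>0\<close> vanishes altogether, because its column is
  infinitesimal and \<open>\<epsilon>\<^sup>2 = 0\<close>. Hence every \<open>f\<^sub>i\<close> is exactly \<open>1\<close>, or exactly \<open>0\<close>, or has standard part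
  strictly between \<open>0\<close> and \<open>1\<close>; in the last case \<open>f\<^sub>i\<close> and \<open>1 - f\<^sub>i\<close> have appreciable square roots
  \<open>c\<^sub>i\<close> and \<open>s\<^sub>i\<close>.

  Columns of appreciable norm can be normalised and completed to a unitary matrix; multiplying by its
  adjoint turns them into a diagonal block (\<open>orthogonal_columns_reduction\<close>). What this leaves of
  \<open>M\<close> lies in the columns with \<open>f\<^sub>i = 0\<close>, and what it leaves of \<open>N\<close> in the columns with \<open>f\<^sub>i = 1\<close>. Both
  remainders are infinitesimal, hence governed by one real quaternion matrix each, and the singular
  value decompositions of these two matrices (\<open>infinitesimal_svd\<close>) produce \<open>D\<close> and \<open>\<Sigma>\<close>. The rotations
  that they need act on columns where the other block is an identity, and the identity is restored by
  rotating the rows in the same way. This gives the first block column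
  (\<open>block_column_decomposition\<close>).

  The second block column then costs nothing. The target matrix is itself unitary
  (\<open>cs_form_unitary\<close>), and two unitary matrices with the same first block column differ by a right
  factor \<open>diag(I, Z)\<close> with \<open>Z\<close> unitary (\<open>unitary_complete_block_column\<close>).

  Two facts of linear algebra carry this. Dual quaternion Hermitian matrices are unitarily
  diagonalisable with eigenvalues in decreasing lexicographic order
  (\<open>dual_quat_hermitian_diagonalisation\<close>): one diagonalises the standard part, removes the
  infinitesimal entries between different eigenvalues by a rotation \<open>I + Q\<epsilon>\<close>, and diagonalises the
  remaining infinitesimal part inside the eigenspaces. Both diagonalisations are instances of
  \<open>quat_hermitian_diagonalisation\<close>, which maximises a weighted trace over a compact group of unitary
  matrices. Orthonormal columns \<open>B\<close> extend to a unitary matrix (\<open>orthonormal_completion\<close>), since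
  diagonalising the projection \<open>I - BB\<^sup>*\<close> exhibits an orthonormal basis of its range.
\<close>

section \<open>Adjoints and unitary matrices over a ring with involution\<close>

text \<open>The adjoint calculus is needed for quaternions and for dual quaternions alike. It rests on a
  conjugation that reverses products.\<close>

class star_ring = ring_1 +
  fixes star :: "'a \<Rightarrow> 'a"
  assumes star_add: "star (x + y) = star x + star y"
    and star_mult: "star (x * y) = star y * star x"
    and star_star [simp]: "star (star x) = x"
begin

lemma star_zero [simp]: "star 0 = 0"
  by (metis add_cancel_right_left star_add)

lemma star_eq_0_iff [simp]: "star x = 0 \<longleftrightarrow> x = 0"
  by (metis star_star star_zero)

lemma star_one [simp]: "star 1 = 1"
  by (metis mult.left_neutral mult.right_neutral star_mult star_star)

lemma star_minus: "star (- x) = - star x"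
  by (metis add.right_inverse add_eq_0_iff star_add star_zero)

lemma star_sum: "star (sum f A) = (\<Sum>i\<in>A. star (f i))"
  by (induction A rule: infinite_finite_induct) (auto simp: star_add)

end

instantiation quat :: star_ring
begin

definition star_quat :: "quat \<Rightarrow> quat" where "star_quat = qcnj"

instance
  by standard (auto simp: star_quat_def quat_eq_iff)

end

instantiation dual :: (star_ring) star_ring
begin

definition star_dual :: "'a dual \<Rightarrow> 'a dual" where "star_dual = map_dual star"

instance
  by standard (auto simp: star_dual_def dual_eq_iff dual.map_sel star_add star_mult add.commute)

end

lemma star_dual_sel [simp]:
  "std_part (star x) = star (std_part x)" "inf_part (star x) = star (inf_part x)"
  by (simp_all add: star_dual_def dual.map_sel)

definition adj :: "'a::star_ring mat \<Rightarrow> 'a mat" where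
  "adj A = transpose_mat (map_mat star A)"

lemma dq_adjoint_eq_adj: "dq_adjoint = adj"
  by (simp add: fun_eq_iff dq_adjoint_def adj_def star_dual_def star_quat_def)

lemma adj_dim [simp]: "dim_row (adj A) = dim_col A" "dim_col (adj A) = dim_row A"
  by (simp_all add: adj_def)

lemma adj_carrier [simp, intro]: "A \<in> carrier_mat m n \<Longrightarrow> adj A \<in> carrier_mat n m"
  by (auto simp: adj_def)

lemma adj_index [simp]:
  "i < dim_col A \<Longrightarrow> j < dim_row A \<Longrightarrow> adj A $$ (i, j) = star (A $$ (j, i))"
  by (simp add: adj_def)

lemma adj_adj [simp]: "adj (adj A) = A"
  by (rule eq_matI) auto

lemma adj_one [simp]: "adj (1\<^sub>m n) = 1\<^sub>m n"
  by (rule eq_matI) auto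

lemma adj_zero [simp]: "adj (0\<^sub>m m n) = 0\<^sub>m n m"
  by (rule eq_matI) auto

lemma mult_mat_index:
  assumes "A \<in> carrier_mat m n" "B \<in> carrier_mat n k" "i < m" "j < k"
  shows "(A * B) $$ (i, j) = (\<Sum>l<n. A $$ (i, l) * B $$ (l, j))"
  using assms by (auto simp: scalar_prod_def lessThan_atLeast0 intro!: sum.cong)

lemma adj_mult:
  assumes "A \<in> carrier_mat m n" "B \<in> carrier_mat n k"
  shows "adj (A * B) = adj B * adj A"
proof (rule eq_matI)
  fix i j assume "i < dim_row (adj B * adj A)" "j < dim_col (adj B * adj A)"
  then have ij: "i < k" "j < m" using assms by auto
  have "adj (A * B) $$ (i, j) = star ((A * B) $$ (j, i))"
    using assms ij by (intro adj_index) auto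
  also have "\<dots> = (\<Sum>l<n. star (B $$ (l, i)) * star (A $$ (j, l)))"
    using mult_mat_index[OF assms ij(2,1)] by (simp add: star_sum star_mult)
  also have "\<dots> = (adj B * adj A) $$ (i, j)"
    using assms ij
    by (subst mult_mat_index[OF adj_carrier[OF assms(2)] adj_carrier[OF assms(1)]]) auto
  finally show "adj (A * B) $$ (i, j) = (adj B * adj A) $$ (i, j)" .
qed (use assms in auto)

lemma adj_mat_diag: "adj (mat_diag n f) = mat_diag n (\<lambda>i. star (f i))"
  by (rule eq_matI) (auto simp: mat_diag_def)

definition unitary_mat :: "nat \<Rightarrow> 'a::star_ring mat \<Rightarrow> bool" where
  "unitary_mat n U \<longleftrightarrow> U \<in> carrier_mat n n \<and> adj U * U = 1\<^sub>m n \<and> U * adj U = 1\<^sub>m n"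

lemma dq_unitary_iff: "U \<in> carrier_mat n n \<Longrightarrow> dq_unitary U \<longleftrightarrow> unitary_mat n U"
  by (auto simp: dq_unitary_def unitary_mat_def dq_adjoint_eq_adj)

lemma unitary_matD:
  assumes "unitary_mat n U"
  shows "U \<in> carrier_mat n n" "adj U \<in> carrier_mat n n" "adj U * U = 1\<^sub>m n" "U * adj U = 1\<^sub>m n"
  using assms by (auto simp: unitary_mat_def)

lemma unitary_mat_one: "unitary_mat n (1\<^sub>m n)"
  by (simp add: unitary_mat_def)

lemma unitary_mat_adj: "unitary_mat n U \<Longrightarrow> unitary_mat n (adj U)"
  by (auto simp: unitary_mat_def)

lemma isometry_mult_cancel:
  assumes "adj U * U = 1\<^sub>m n" "U \<in> carrier_mat m n" "X \<in> carrier_mat n k"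
  shows "adj U * (U * X) = X"
proof -
  have "adj U * (U * X) = adj U * U * X"
    using assms by (intro assoc_mult_mat[symmetric, of _ n m _ n _ k]) simp_all
  then show ?thesis using assms by simp
qed

lemma unitary_mult_cancel:
  assumes "unitary_mat n U" "X \<in> carrier_mat n k"
  shows "adj U * (U * X) = X" "U * (adj U * X) = X"
  using isometry_mult_cancel[of U n n X k] isometry_mult_cancel[of "adj U" n n X k] assms
  by (auto simp: unitary_mat_def)

lemma unitary_mat_mult:
  assumes "unitary_mat n U" "unitary_mat n V"
  shows "unitary_mat n (U * V)"
proof -
  note U = unitary_matD[OF assms(1)] and V = unitary_matD[OF assms(2)]
  have UV: "U * V \<in> carrier_mat n n" "adj V * adj U \<in> carrier_mat n n" using U V by auto
  have "adj (U * V) * (U * V) = adj V * adj U * (U * V)"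
    by (simp add: adj_mult[OF U(1) V(1)])
  also have "\<dots> = adj V * (adj U * (U * V))"
    using U V UV by (intro assoc_mult_mat[of _ n n _ n _ n]) simp_all
  also have "\<dots> = 1\<^sub>m n"
    using unitary_mult_cancel(1)[OF assms(1) V(1)] V by simp
  finally have 1: "adj (U * V) * (U * V) = 1\<^sub>m n" .
  have "(U * V) * adj (U * V) = U * V * (adj V * adj U)"
    by (simp add: adj_mult[OF U(1) V(1)])
  also have "\<dots> = U * (V * (adj V * adj U))"
    using U V UV by (intro assoc_mult_mat[of _ n n _ n _ n]) simp_all
  also have "\<dots> = 1\<^sub>m n"
    using unitary_mult_cancel(2)[OF assms(2) U(2)] U by simp
  finally show ?thesis
    using 1 U V by (auto simp: unitary_mat_def)
qed

lemma sandwich_carrier: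
  assumes "U \<in> carrier_mat m n" "A \<in> carrier_mat m p" "V \<in> carrier_mat p q"
  shows "adj U * A * V \<in> carrier_mat n q"
  using mult_carrier_mat[OF mult_carrier_mat[OF adj_carrier[OF assms(1)] assms(2)] assms(3)] .

text \<open>Unitary transformations are applied to a matrix in several rounds; this moves the inner round
  next to the matrix.\<close>

lemma adj_mult_sandwich:
  assumes "U \<in> carrier_mat m n" "U' \<in> carrier_mat n k" "A \<in> carrier_mat m p"
    "V \<in> carrier_mat p q" "V' \<in> carrier_mat q r"
  shows "adj (U * U') * A * (V * V') = adj U' * (adj U * A * V) * V'"
proof -
  have c: "adj U \<in> carrier_mat n m" "adj U' \<in> carrier_mat k n" using assms by auto
  have c': "adj U * A \<in> carrier_mat n p" using c(1) assms(3) by (rule mult_carrier_mat)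
  then have c'': "adj U' * (adj U * A) \<in> carrier_mat k p"
    by (rule mult_carrier_mat[OF c(2)])
  have "adj (U * U') * A * (V * V') = adj U' * adj U * A * (V * V')"
    using assms by (simp add: adj_mult[of U m n U' k])
  also have "adj U' * adj U * A = adj U' * (adj U * A)"
    using assms c by (intro assoc_mult_mat[of _ k n _ m _ p]) simp_all
  also have "adj U' * (adj U * A) * (V * V') = adj U' * (adj U * A) * V * V'"
    using assms c'' by (intro assoc_mult_mat[symmetric, of _ k p _ q _ r]) simp_all
  also have "adj U' * (adj U * A) * V = adj U' * (adj U * A * V)"
    using assms c c' by (intro assoc_mult_mat[of _ k n _ p _ q]) simp_all
  finally show ?thesis .
qed

section \<open>Matrices in blocks\<close>

definition dsum :: "'a::zero mat \<Rightarrow> 'a mat \<Rightarrow> 'a mat"  (infixr \<open>\<oplus>\<^sub>m\<close> 66) where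
  "A \<oplus>\<^sub>m B = four_block_mat A (0\<^sub>m (dim_row A) (dim_col B)) (0\<^sub>m (dim_row B) (dim_col A)) B"

text \<open>A matrix with no rows is placed below, so that the multiplication law of four-block matrices also
  governs side by side blocks.\<close>

definition hcat :: "'a::zero mat \<Rightarrow> 'a mat \<Rightarrow> 'a mat" where
  "hcat B C = four_block_mat B C (0\<^sub>m 0 (dim_col B)) (0\<^sub>m 0 (dim_col C))"

lemma block_diag2_eq_dsum: "block_diag2 A B = A \<oplus>\<^sub>m B"
  by (simp add: block_diag2_def dsum_def)

lemma dsum_dim [simp]:
  "dim_row (A \<oplus>\<^sub>m B) = dim_row A + dim_row B" "dim_col (A \<oplus>\<^sub>m B) = dim_col A + dim_col B"
  by (simp_all add: dsum_def)

lemma dsum_carrier [simp, intro]: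
  "A \<in> carrier_mat m n \<Longrightarrow> B \<in> carrier_mat p q \<Longrightarrow> A \<oplus>\<^sub>m B \<in> carrier_mat (m + p) (n + q)"
  by (simp add: dsum_def)

lemma dsum_assoc: "(A \<oplus>\<^sub>m B) \<oplus>\<^sub>m C = A \<oplus>\<^sub>m B \<oplus>\<^sub>m C"
  unfolding dsum_def by (rule assoc_four_block_mat[symmetric])

lemma dsum_empty [simp]: "A \<oplus>\<^sub>m 0\<^sub>m 0 0 = A"
  by (rule eq_matI) (auto simp: dsum_def)

lemma diag_block_mat_Cons_dsum: "diag_block_mat (A # As) = A \<oplus>\<^sub>m diag_block_mat As"
  by (simp add: dsum_def Let_def)

lemma dsum_mult:
  fixes A B C D :: "'a::semiring_0 mat"
  assumes "dim_col A = dim_row C" "dim_col B = dim_row D"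
  shows "(A \<oplus>\<^sub>m B) * (C \<oplus>\<^sub>m D) = (A * C) \<oplus>\<^sub>m (B * D)"
proof -
  define m n p q where "m = dim_row A" and "n = dim_row B" and "p = dim_col C" and "q = dim_col D"
  define k l where "k = dim_row C" and "l = dim_row D"
  have c: "A \<in> carrier_mat m k" "B \<in> carrier_mat n l" "C \<in> carrier_mat k p" "D \<in> carrier_mat l q"
    using assms by (auto simp: m_def n_def p_def q_def k_def l_def intro: carrier_matI)
  have "(A \<oplus>\<^sub>m B) * (C \<oplus>\<^sub>m D) = four_block_mat (A * C + 0\<^sub>m m l * 0\<^sub>m l p)
      (A * 0\<^sub>m k q + 0\<^sub>m m l * D) (0\<^sub>m n k * C + B * 0\<^sub>m l p) (0\<^sub>m n k * 0\<^sub>m k q + B * D)"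
    unfolding dsum_def using c by (simp only: carrier_matD)
      (rule mult_four_block_mat[of _ m k _ l _ n _ _ p _ q]; simp)
  also have "\<dots> = (A * C) \<oplus>\<^sub>m (B * D)"
    unfolding dsum_def using c by (intro cong_four_block_mat) auto
  finally show ?thesis .
qed

lemma dsum_add:
  fixes A B C D :: "'a::monoid_add mat"
  assumes "dim_row A = dim_row C" "dim_col A = dim_col C" "dim_row B = dim_row D" "dim_col B = dim_col D"
  shows "(A \<oplus>\<^sub>m B) + (C \<oplus>\<^sub>m D) = (A + C) \<oplus>\<^sub>m (B + D)"
  using assms by (intro eq_matI) (auto simp: dsum_def)

lemma dsum_zero: "0\<^sub>m m n \<oplus>\<^sub>m 0\<^sub>m p q = 0\<^sub>m (m + p) (n + q)"
  by (simp add: dsum_def)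

lemma dsum_one: "1\<^sub>m m \<oplus>\<^sub>m 1\<^sub>m n = 1\<^sub>m (m + n)"
  by (simp add: dsum_def)

lemma adj_dsum: "adj (A \<oplus>\<^sub>m B) = adj A \<oplus>\<^sub>m adj B"
  by (rule eq_matI) (auto simp: dsum_def)

lemma mat_diag_add: "mat_diag (k + l) f = mat_diag k f \<oplus>\<^sub>m mat_diag l (\<lambda>i. f (k + i))"
  by (rule eq_matI) (auto simp: dsum_def mat_diag_def)

lemma four_block_mat_inject:
  assumes "four_block_mat A B C D = four_block_mat A' B' C' D'"
    and "A \<in> carrier_mat m n" "B \<in> carrier_mat m q" "C \<in> carrier_mat p n" "D \<in> carrier_mat p q"
    and "A' \<in> carrier_mat m n" "B' \<in> carrier_mat m q" "C' \<in> carrier_mat p n" "D' \<in> carrier_mat p q"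
  shows "A = A'" "B = B'" "C = C'" "D = D'"
proof -
  have *: "four_block_mat A B C D $$ (i, j) = four_block_mat A' B' C' D' $$ (i, j)" for i j
    using assms(1) by simp
  show "A = A'"
  proof (rule eq_matI)
    fix i j assume "i < dim_row A'" "j < dim_col A'"
    then show "A $$ (i, j) = A' $$ (i, j)" using *[of i j] assms(2-) by auto
  qed (use assms in auto)
  show "B = B'"
  proof (rule eq_matI)
    fix i j assume "i < dim_row B'" "j < dim_col B'"
    then show "B $$ (i, j) = B' $$ (i, j)" using *[of i "n + j"] assms(2-) by auto
  qed (use assms in auto)
  show "C = C'"
  proof (rule eq_matI)
    fix i j assume "i < dim_row C'" "j < dim_col C'"
    then show "C $$ (i, j) = C' $$ (i, j)" using *[of "m + i" j] assms(2-) by auto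
  qed (use assms in auto)
  show "D = D'"
  proof (rule eq_matI)
    fix i j assume "i < dim_row D'" "j < dim_col D'"
    then show "D $$ (i, j) = D' $$ (i, j)" using *[of "m + i" "n + j"] assms(2-) by auto
  qed (use assms in auto)
qed

lemma adj_four_block_mat:
  assumes "A \<in> carrier_mat m n" "B \<in> carrier_mat m q" "C \<in> carrier_mat p n" "D \<in> carrier_mat p q"
  shows "adj (four_block_mat A B C D) = four_block_mat (adj A) (adj C) (adj B) (adj D)"
  by (rule eq_matI) (use assms in auto)

lemma unitary_mat_dsum:
  assumes "unitary_mat m U" "unitary_mat n V"
  shows "unitary_mat (m + n) (U \<oplus>\<^sub>m V)"
  using assms by (auto simp: unitary_mat_def adj_dsum dsum_mult dsum_one)

lemma hcat_carrier [simp, intro]: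
  "B \<in> carrier_mat m k \<Longrightarrow> C \<in> carrier_mat m j \<Longrightarrow> hcat B C \<in> carrier_mat m (k + j)"
  using four_block_carrier_mat[of B m k "0\<^sub>m 0 (dim_col C)" 0 j] by (simp add: hcat_def)

lemma hcat_split:
  assumes "M \<in> carrier_mat m (k + j)"
  obtains B C where "B \<in> carrier_mat m k" "C \<in> carrier_mat m j" "M = hcat B C"
proof
  show "mat m k (\<lambda>(i, l). M $$ (i, l)) \<in> carrier_mat m k" by simp
  show "mat m j (\<lambda>(i, l). M $$ (i, k + l)) \<in> carrier_mat m j" by simp
  show "M = hcat (mat m k (\<lambda>(i, l). M $$ (i, l))) (mat m j (\<lambda>(i, l). M $$ (i, k + l)))"
    by (rule eq_matI) (use assms in \<open>auto simp: hcat_def\<close>)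
qed

lemma adj_hcat_mult:
  assumes "B \<in> carrier_mat m k" "C \<in> carrier_mat m j" "X \<in> carrier_mat m p" "Y \<in> carrier_mat m q"
  shows "adj (hcat B C) * hcat X Y
    = four_block_mat (adj B * X) (adj B * Y) (adj C * X) (adj C * Y)"
proof -
  have "adj (hcat B C) = four_block_mat (adj B) (0\<^sub>m k 0) (adj C) (0\<^sub>m j 0)"
    unfolding hcat_def using assms
    by (subst adj_four_block_mat[of _ m k _ j _ 0]) auto
  then show ?thesis
    unfolding hcat_def using assms
    by (simp only: carrier_matD) (subst mult_four_block_mat[of _ k m _ 0 _ j _ _ p _ q]; auto)
qed

lemma hcat_mult_adj:
  assumes "B \<in> carrier_mat m k" "C \<in> carrier_mat m j" "X \<in> carrier_mat p k" "Y \<in> carrier_mat p j"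
  shows "hcat B C * adj (hcat X Y) = B * adj X + C * adj Y"
proof -
  have "adj (hcat X Y) = four_block_mat (adj X) (0\<^sub>m k 0) (adj Y) (0\<^sub>m j 0)"
    unfolding hcat_def using assms
    by (subst adj_four_block_mat[of _ p k _ j _ 0]) auto
  then have "hcat B C * adj (hcat X Y)
      = four_block_mat (B * adj X + C * adj Y) (0\<^sub>m m 0) (0\<^sub>m 0 p) (0\<^sub>m 0 0)"
    unfolding hcat_def using assms
    by (simp only: carrier_matD) (subst mult_four_block_mat[of _ m k _ j _ 0 _ _ p _ 0]; auto)
  also have "\<dots> = B * adj X + C * adj Y"
    by (rule eq_matI) (use assms in auto)
  finally show ?thesis .
qed

lemma hcat_mult_dsum:
  fixes B C X Y :: "'a::semiring_0 mat"
  assumes "B \<in> carrier_mat m k" "C \<in> carrier_mat m j" "X \<in> carrier_mat k p" "Y \<in> carrier_mat j q"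
  shows "hcat B C * (X \<oplus>\<^sub>m Y) = hcat (B * X) (C * Y)"
proof -
  have "hcat B C * (X \<oplus>\<^sub>m Y) = four_block_mat (B * X + C * 0\<^sub>m j p) (B * 0\<^sub>m k q + C * Y)
      (0\<^sub>m 0 k * X + 0\<^sub>m 0 j * 0\<^sub>m j p) (0\<^sub>m 0 k * 0\<^sub>m k q + 0\<^sub>m 0 j * Y)"
    unfolding hcat_def dsum_def using assms
    by (simp only: carrier_matD) (rule mult_four_block_mat[of _ m k _ j _ 0 _ _ p _ q]; simp)
  also have "\<dots> = hcat (B * X) (C * Y)"
    unfolding hcat_def using assms by (intro cong_four_block_mat) auto
  finally show ?thesis .
qed

section \<open>Quaternions as a real algebra with involution\<close>

lemma star_quat_sel [simp]:
  "QRe (star x) = QRe x" "QIm1 (star x) = - QIm1 x" "QIm2 (star x) = - QIm2 x" "QIm3 (star x) = - QIm3 x"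
  by (simp_all add: star_quat_def)

lemma star_scaleR [simp]: "star (a *\<^sub>R (x::quat)) = a *\<^sub>R star x"
  by (simp add: quat_eq_iff)

lemma quat_of_real_sel [simp]:
  "QRe (of_real a) = a" "QIm1 (of_real a) = 0" "QIm2 (of_real a) = 0" "QIm3 (of_real a) = 0"
  by (simp_all add: of_real_def)

lemma quat_sum_sel:
  "QRe (sum f A) = (\<Sum>i\<in>A. QRe (f i))" "QIm1 (sum f A) = (\<Sum>i\<in>A. QIm1 (f i))"
  "QIm2 (sum f A) = (\<Sum>i\<in>A. QIm2 (f i))" "QIm3 (sum f A) = (\<Sum>i\<in>A. QIm3 (f i))"
  by (induction A rule: infinite_finite_induct; simp)+

definition qnorm2 :: "quat \<Rightarrow> real" where
  "qnorm2 q = (QRe q)\<^sup>2 + (QIm1 q)\<^sup>2 + (QIm2 q)\<^sup>2 + (QIm3 q)\<^sup>2"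

lemma qnorm2_nonneg [simp]: "0 \<le> qnorm2 q"
  by (simp add: qnorm2_def)

lemma qnorm2_eq_0_iff [simp]: "qnorm2 q = 0 \<longleftrightarrow> q = 0"
  by (auto simp: qnorm2_def quat_eq_iff add_nonneg_eq_0_iff)

lemma qnorm2_star [simp]: "qnorm2 (star q) = qnorm2 q"
  by (simp add: qnorm2_def)

lemma qnorm2_scaleR: "qnorm2 (a *\<^sub>R q) = a\<^sup>2 * qnorm2 q"
  by (simp add: qnorm2_def power_mult_distrib distrib_left)

lemma star_mult_self: "star q * q = of_real (qnorm2 q)" "q * star q = of_real (qnorm2 q)"
  by (simp_all add: quat_eq_iff qnorm2_def power2_eq_square)

lemma QRe_commute: "QRe (x * y) = QRe (y * x)"
  by simp

lemma self_star_quat: "star (q::quat) = q \<Longrightarrow> q = of_real (QRe q)"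
  by (auto simp: quat_eq_iff)

lemma quat_unit_multiplier:
  obtains q where "qnorm2 q = 1" "QRe (z * q) = sqrt (qnorm2 z)"
proof (cases "z = 0")
  case True
  then show ?thesis
    using that[of 1] by (simp add: qnorm2_def)
next
  case False
  define r where "r = sqrt (qnorm2 z)"
  have r: "r > 0" "r\<^sup>2 = qnorm2 z"
    using False by (auto simp: r_def order.strict_iff_order)
  show ?thesis
  proof (rule that)
    show "qnorm2 ((1 / r) *\<^sub>R star z) = 1"
      using r False by (simp add: qnorm2_scaleR power_divide)
    have "QRe (z * (1 / r) *\<^sub>R star z) = r\<^sup>2 / r"
      unfolding r(2) by (simp add: star_mult_self del: times_quat.sel)
    also have "\<dots> = r" using r(1) by (simp add: power2_eq_square)
    finally show "QRe (z * (1 / r) *\<^sub>R star z) = sqrt (qnorm2 z)"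
      by (simp only: r_def)
  qed
qed

section \<open>Compactness of groups of unitary quaternion matrices\<close>

text \<open>Continuity of quaternion-valued maps is taken coordinatewise, which avoids a topology on the type
  of quaternions.\<close>

definition quat_continuous :: "('x::topological_space \<Rightarrow> quat) \<Rightarrow> bool" where
  "quat_continuous g \<longleftrightarrow> continuous_on UNIV (\<lambda>x. QRe (g x)) \<and> continuous_on UNIV (\<lambda>x. QIm1 (g x))
     \<and> continuous_on UNIV (\<lambda>x. QIm2 (g x)) \<and> continuous_on UNIV (\<lambda>x. QIm3 (g x))"

lemma quat_continuous_const: "quat_continuous (\<lambda>x. q)"
  by (simp add: quat_continuous_def)

lemma quat_continuous_star: "quat_continuous g \<Longrightarrow> quat_continuous (\<lambda>x. star (g x))"
  by (auto simp: quat_continuous_def intro!: continuous_intros)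

lemma quat_continuous_mult:
  "quat_continuous g \<Longrightarrow> quat_continuous h \<Longrightarrow> quat_continuous (\<lambda>x. g x * h x)"
  by (auto simp: quat_continuous_def intro!: continuous_intros)

lemma quat_continuous_sum:
  "(\<And>i. i \<in> A \<Longrightarrow> quat_continuous (g i)) \<Longrightarrow> quat_continuous (\<lambda>x. \<Sum>i\<in>A. g i x)"
  by (auto simp: quat_continuous_def quat_sum_sel intro!: continuous_intros)

lemma closed_quat_eq:
  assumes "quat_continuous g"
  shows "closed {x. g x = q}"
  using assms unfolding quat_continuous_def quat_eq_iff
  by (auto intro!: closed_Collect_conj closed_Collect_eq continuous_on_const)

definition mat_continuous :: "nat \<Rightarrow> nat \<Rightarrow> ('x::topological_space \<Rightarrow> quat mat) \<Rightarrow> bool" where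
  "mat_continuous m n M \<longleftrightarrow>
     (\<forall>x. M x \<in> carrier_mat m n) \<and> (\<forall>i<m. \<forall>j<n. quat_continuous (\<lambda>x. M x $$ (i, j)))"

lemma mat_continuous_const: "A \<in> carrier_mat m n \<Longrightarrow> mat_continuous m n (\<lambda>x. A)"
  by (simp add: mat_continuous_def quat_continuous_const)

lemma mat_continuous_adj:
  assumes "mat_continuous m n M"
  shows "mat_continuous n m (\<lambda>x. adj (M x))"
proof -
  have M: "M x \<in> carrier_mat m n" for x using assms by (simp add: mat_continuous_def)
  have "adj (M x) $$ (i, j) = star (M x $$ (j, i))" if "i < n" "j < m" for x i j
    using M[of x] that by (intro adj_index) auto
  then show ?thesis
    using assms M by (auto simp: mat_continuous_def quat_continuous_star)
qed

lemma mat_continuous_mult: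
  assumes "mat_continuous m n M" "mat_continuous n k N"
  shows "mat_continuous m k (\<lambda>x. M x * N x)"
proof -
  have M: "M x \<in> carrier_mat m n" "N x \<in> carrier_mat n k" for x
    using assms by (auto simp: mat_continuous_def)
  have "(M x * N x) $$ (i, j) = (\<Sum>l<n. M x $$ (i, l) * N x $$ (l, j))" if "i < m" "j < k" for x i j
    using M that by (rule mult_mat_index)
  then show ?thesis
    using assms M
    by (auto simp: mat_continuous_def intro!: quat_continuous_sum quat_continuous_mult)
       (metis M(1) M(2) carrier_matD mult_carrier_mat)+
qed

lemma closed_mat_eq:
  assumes "mat_continuous m n M" "A \<in> carrier_mat m n"
  shows "closed {x. M x = A}"
proof -
  have M: "M x \<in> carrier_mat m n" for x using assms by (simp add: mat_continuous_def)
  have "{x. M x = A} = (\<Inter>i\<in>{..<m}. \<Inter>j\<in>{..<n}. {x. M x $$ (i, j) = A $$ (i, j)})"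
  proof (intro equalityI subsetI)
    fix x assume x: "x \<in> (\<Inter>i\<in>{..<m}. \<Inter>j\<in>{..<n}. {x. M x $$ (i, j) = A $$ (i, j)})"
    have "M x = A"
      by (rule eq_matI) (use x M[of x] assms(2) in auto)
    then show "x \<in> {x. M x = A}" by simp
  qed auto
  then show ?thesis
    using assms(1) by (auto simp: mat_continuous_def intro!: closed_INT closed_quat_eq)
qed

text \<open>If \<open>\<gamma>\<close> lists the eigenvalues of a diagonal matrix, these are the unitary matrices that commute with
  it, that is, which preserve its eigenspaces. For constant \<open>\<gamma>\<close> they form the whole unitary group.\<close>

definition block_unitary :: "nat \<Rightarrow> (nat \<Rightarrow> real) \<Rightarrow> quat mat set" where
  "block_unitary n \<gamma> =
     {U. unitary_mat n U \<and> (\<forall>i<n. \<forall>j<n. \<gamma> i \<noteq> \<gamma> j \<longrightarrow> U $$ (i, j) = 0)}"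

text \<open>A quaternion matrix is encoded by its real coordinates, so that compactness of a cube in the
  product topology on functions (Tychonov) can be used.\<close>

definition mat_of_coords :: "nat \<Rightarrow> (nat \<times> nat \<times> nat \<Rightarrow> real) \<Rightarrow> quat mat" where
  "mat_of_coords n F =
     mat n n (\<lambda>(i, j). Quat (F (i, j, 0)) (F (i, j, 1)) (F (i, j, 2)) (F (i, j, 3)))"

lemma mat_continuous_mat_of_coords: "mat_continuous n n (mat_of_coords n)"
  by (auto simp: mat_continuous_def mat_of_coords_def quat_continuous_def)

lemma unitary_entry_bound:
  assumes "unitary_mat n (U :: quat mat)" "i < n" "j < n"
  shows "qnorm2 (U $$ (i, j)) \<le> 1"
proof -
  note U = unitary_matD[OF assms(1)]
  have "(adj U * U) $$ (j, j) = (\<Sum>l<n. star (U $$ (l, j)) * U $$ (l, j))"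
    using U assms by (subst mult_mat_index[OF U(2) U(1)]) auto
  then have "(\<Sum>l<n. qnorm2 (U $$ (l, j))) = QRe ((adj U * U) $$ (j, j))"
    by (simp only: star_mult_self quat_sum_sel quat_of_real_sel)
  then have "(\<Sum>l<n. qnorm2 (U $$ (l, j))) = 1"
    using U assms by simp
  moreover have "qnorm2 (U $$ (i, j)) \<le> (\<Sum>l<n. qnorm2 (U $$ (l, j)))"
    using assms by (intro member_le_sum) auto
  ultimately show ?thesis by simp
qed

lemma abs_le_1_if_qnorm2_le_1:
  assumes "qnorm2 q \<le> 1"
  shows "\<bar>QRe q\<bar> \<le> 1" "\<bar>QIm1 q\<bar> \<le> 1" "\<bar>QIm2 q\<bar> \<le> 1" "\<bar>QIm3 q\<bar> \<le> 1"
proof -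
  have "(QRe q)\<^sup>2 \<le> 1 \<and> (QIm1 q)\<^sup>2 \<le> 1 \<and> (QIm2 q)\<^sup>2 \<le> 1 \<and> (QIm3 q)\<^sup>2 \<le> 1"
    using assms zero_le_power2[of "QRe q"] zero_le_power2[of "QIm1 q"] zero_le_power2[of "QIm2 q"]
      zero_le_power2[of "QIm3 q"]
    unfolding qnorm2_def by linarith
  then show "\<bar>QRe q\<bar> \<le> 1" "\<bar>QIm1 q\<bar> \<le> 1" "\<bar>QIm2 q\<bar> \<le> 1" "\<bar>QIm3 q\<bar> \<le> 1"
    by (simp_all add: abs_square_le_1)
qed

text \<open>The entries of a unitary matrix have norm at most \<open>1\<close>, so the group corresponds to a closed subset of
  a cube of coordinates, and the weighted trace is a polynomial in these coordinates.\<close>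

lemma block_unitary_trace_attains_max:
  assumes H: "H \<in> carrier_mat n n"
  obtains U where "U \<in> block_unitary n \<gamma>"
    and "\<And>V. V \<in> block_unitary n \<gamma> \<Longrightarrow>
      (\<Sum>k<n. w k * QRe ((adj V * H * V) $$ (k, k))) \<le> (\<Sum>k<n. w k * QRe ((adj U * H * U) $$ (k, k)))"
proof -
  define f where "f = (\<lambda>U. \<Sum>k<n. w k * QRe ((adj U * H * U) $$ (k, k)))"
  define M where "M = mat_of_coords n"
  define K where "K = (\<Pi>\<^sub>E x\<in>(UNIV :: (nat \<times> nat \<times> nat) set). {-1..1::real})"
  define S where "S = K \<inter> {F. M F \<in> block_unitary n \<gamma>}"
  have M: "mat_continuous n n M"
    by (simp add: M_def mat_continuous_mat_of_coords)
  have Mc: "M F \<in> carrier_mat n n" for F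
    using M by (simp add: mat_continuous_def)
  have "compactin euclidean K"
    unfolding K_def euclidean_product_topology[symmetric] compactin_PiE by simp
  then have "compact K" by simp
  moreover have "closed {F. M F \<in> block_unitary n \<gamma>}"
  proof -
    have "{F. M F \<in> block_unitary n \<gamma>}
      = {F. adj (M F) * M F = 1\<^sub>m n} \<inter> {F. M F * adj (M F) = 1\<^sub>m n}
        \<inter> (\<Inter>i\<in>{..<n}. \<Inter>j\<in>{j. j < n \<and> \<gamma> i \<noteq> \<gamma> j}. {F. M F $$ (i, j) = 0})"
      using Mc by (auto simp: block_unitary_def unitary_mat_def)
    moreover have "closed \<dots>"
      using M
      by (intro closed_Int closed_mat_eq[of n n] closed_INT ballI mat_continuous_mult[of n n]
          mat_continuous_adj closed_quat_eq) (auto simp: mat_continuous_def)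
    ultimately show ?thesis by simp
  qed
  ultimately have "compact S"
    unfolding S_def by (rule compact_Int_closed)
  have onto: "\<exists>F\<in>S. M F = U" if U: "U \<in> block_unitary n \<gamma>" for U
  proof -
    have uU: "unitary_mat n U" using U by (simp add: block_unitary_def)
    define F :: "nat \<times> nat \<times> nat \<Rightarrow> real" where
      "F = (\<lambda>(i, j, k). if i < n \<and> j < n then
          (if k = 0 then QRe (U $$ (i, j)) else if k = 1 then QIm1 (U $$ (i, j))
           else if k = 2 then QIm2 (U $$ (i, j)) else QIm3 (U $$ (i, j))) else 0)"
    have "M F = U"
      unfolding M_def mat_of_coords_def F_def
      by (rule eq_matI) (use unitary_matD[OF uU] in \<open>auto simp: quat_eq_iff\<close>)
    moreover have "F x \<in> {-1..1}" for x
    proof -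
      obtain i j k where x: "x = (i, j, k)" by (cases x)
      have "\<bar>F x\<bar> \<le> 1"
        using abs_le_1_if_qnorm2_le_1[OF unitary_entry_bound[OF uU, of i j]]
        by (auto simp: F_def x)
      then show ?thesis by auto
    qed
    ultimately show ?thesis
      using U by (auto simp: S_def K_def)
  qed
  have "1\<^sub>m n \<in> block_unitary n \<gamma>"
    by (auto simp: block_unitary_def unitary_mat_one)
  then have "S \<noteq> {}" using onto by blast
  moreover have "continuous_on S (\<lambda>F. f (M F))"
  proof -
    have "mat_continuous n n (\<lambda>F. adj (M F) * H * M F)"
      by (intro mat_continuous_mult[of n n] mat_continuous_adj mat_continuous_const M H)
    then have "continuous_on UNIV (\<lambda>F. f (M F))"
      unfolding f_def
      by (auto simp: mat_continuous_def quat_continuous_def intro!: continuous_intros)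
    then show ?thesis by (rule continuous_on_subset) simp
  qed
  ultimately obtain F where F: "F \<in> S" "\<forall>G\<in>S. f (M G) \<le> f (M F)"
    using continuous_attains_sup[OF \<open>compact S\<close>] by blast
  show ?thesis
  proof (rule that)
    show "M F \<in> block_unitary n \<gamma>" using F by (simp add: S_def)
    fix V assume "V \<in> block_unitary n \<gamma>"
    then show "(\<Sum>k<n. w k * QRe ((adj V * H * V) $$ (k, k)))
      \<le> (\<Sum>k<n. w k * QRe ((adj (M F) * H * M F) $$ (k, k)))"
      using onto[of V] F(2) by (auto simp: f_def)
  qed
qed

section \<open>Diagonalisation of quaternion Hermitian matrices\<close>

text \<open>The first column of the rotated plane is \<open>c e\<^sub>i + s q e\<^sub>j\<close>, the second one \<open>c e\<^sub>j - s q\<^sup>* e\<^sub>i\<close>; the unit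
  quaternion \<open>q\<close> plays the part of a phase.\<close>

definition plane_rotation :: "nat \<Rightarrow> nat \<Rightarrow> nat \<Rightarrow> real \<Rightarrow> real \<Rightarrow> quat \<Rightarrow> quat mat" where
  "plane_rotation n i j c s q = mat n n (\<lambda>(a, b).
     if a = i \<and> b = i \<or> a = j \<and> b = j then c *\<^sub>R 1
     else if a = j \<and> b = i then s *\<^sub>R q
     else if a = i \<and> b = j then - (s *\<^sub>R star q)
     else if a = b then 1 else 0)"

lemma sum_eq_two:
  assumes "finite A" "i \<in> A" "j \<in> A" "i \<noteq> j" "\<And>a. a \<in> A \<Longrightarrow> a \<noteq> i \<Longrightarrow> a \<noteq> j \<Longrightarrow> g a = 0"
  shows "sum g A = g i + (g j :: 'a::comm_monoid_add)"
proof -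
  have "sum g A = sum g {i, j}"
    using assms by (intro sum.mono_neutral_right) auto
  then show ?thesis using assms by simp
qed

lemma sum_eq_one:
  assumes "finite A" "k \<in> A" "\<And>a. a \<in> A \<Longrightarrow> a \<noteq> k \<Longrightarrow> g a = 0"
  shows "sum g A = (g k :: 'a::comm_monoid_add)"
proof -
  have "sum g A = sum g {k}"
    using assms by (intro sum.mono_neutral_right) auto
  then show ?thesis by simp
qed

context
  fixes n i j :: nat and c s :: real and q :: quat
  assumes ij: "i < n" "j < n" "i \<noteq> j" and cs: "c\<^sup>2 + s\<^sup>2 = 1" and q: "qnorm2 q = 1"
begin

lemma plane_rotation_mult_adj:
  "plane_rotation n i j c s q * adj (plane_rotation n i j c s q) = 1\<^sub>m n"
proof (rule eq_matI)
  let ?G = "plane_rotation n i j c s q"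
  have G: "?G \<in> carrier_mat n n" by (simp add: plane_rotation_def)
  have qq: "q * star q = 1" "star q * q = 1" using q by (simp_all add: star_mult_self)
  have cs': "(c * c) *\<^sub>R (1::quat) + (s * s) *\<^sub>R 1 = 1"
    using cs by (simp add: power2_eq_square flip: scaleR_left_distrib)
  fix a b assume "a < dim_row (1\<^sub>m n)" "b < dim_col (1\<^sub>m n)"
  then have ab: "a < n" "b < n" by auto
  have "(?G * adj ?G) $$ (a, b) = (\<Sum>l<n. ?G $$ (a, l) * star (?G $$ (b, l)))"
    using G ab by (subst mult_mat_index[OF G adj_carrier[OF G]]) auto
  also have "\<dots> = (if a = b then 1 else 0)"
  proof (cases "a = i \<or> a = j")
    case True
    then have "(\<Sum>l<n. ?G $$ (a, l) * star (?G $$ (b, l)))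
        = ?G $$ (a, i) * star (?G $$ (b, i)) + ?G $$ (a, j) * star (?G $$ (b, j))"
      using ij ab by (intro sum_eq_two) (auto simp: plane_rotation_def)
    also have "\<dots> = (if a = b then 1 else 0)"
      using True ij ab cs' qq
      by (auto simp: plane_rotation_def star_minus mult.commute add.commute)
    finally show ?thesis .
  next
    case False
    then have "(\<Sum>l<n. ?G $$ (a, l) * star (?G $$ (b, l))) = ?G $$ (a, a) * star (?G $$ (b, a))"
      using ij ab by (intro sum_eq_one) (auto simp: plane_rotation_def)
    also have "\<dots> = (if a = b then 1 else 0)"
      using False ij ab by (auto simp: plane_rotation_def)
    finally show ?thesis .
  qed
  finally show "(?G * adj ?G) $$ (a, b) = 1\<^sub>m n $$ (a, b)" using ab by simp
qed (simp_all add: plane_rotation_def)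

end

text \<open>The adjoint is again a rotation of this kind, so that one of the two unitarity equations implies the
  other one.\<close>

lemma adj_plane_rotation:
  assumes "i \<noteq> j"
  shows "adj (plane_rotation n i j c s q) = plane_rotation n i j c s (- q)"
  by (rule eq_matI) (use assms in \<open>auto simp: plane_rotation_def star_minus\<close>)

lemma unitary_plane_rotation:
  assumes "i < n" "j < n" "i \<noteq> j" "c\<^sup>2 + s\<^sup>2 = 1" "qnorm2 q = 1"
  shows "unitary_mat n (plane_rotation n i j c s q)"
proof -
  have "qnorm2 (- q) = 1" using assms(5) by (simp add: qnorm2_def)
  from plane_rotation_mult_adj[OF assms(1-4) this]
  have "adj (plane_rotation n i j c s q) * plane_rotation n i j c s q = 1\<^sub>m n"
    by (metis adj_adj adj_plane_rotation assms(3))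
  moreover have "plane_rotation n i j c s q \<in> carrier_mat n n"
    by (simp add: plane_rotation_def)
  ultimately show ?thesis
    using plane_rotation_mult_adj[OF assms] by (simp add: unitary_mat_def)
qed

text \<open>The two rotated diagonal entries keep their sum; the first order change between them is the
  off-diagonal entry seen through the phase \<open>q\<close>.\<close>

lemma plane_rotation_diagonal:
  fixes c s :: real
  assumes ij: "i < n" "j < n" "i \<noteq> j" and q: "qnorm2 q = 1"
    and K: "K \<in> carrier_mat n n" "adj K = K" and k: "k < n"
  defines "K' \<equiv> adj (plane_rotation n i j c s q) * K * plane_rotation n i j c s q"
  defines "\<rho> \<equiv> 2 * c * s * QRe (K $$ (i, j) * q)"
  shows "QRe (K' $$ (k, k)) =
    (if k = i then c\<^sup>2 * QRe (K $$ (i, i)) + s\<^sup>2 * QRe (K $$ (j, j)) + \<rho>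
     else if k = j then s\<^sup>2 * QRe (K $$ (i, i)) + c\<^sup>2 * QRe (K $$ (j, j)) - \<rho>
     else QRe (K $$ (k, k)))"
proof -
  let ?G = "plane_rotation n i j c s q"
  have G: "?G \<in> carrier_mat n n" by (simp add: plane_rotation_def)
  have qq: "q * star q = 1" "star q * q = 1" using q by (simp_all add: star_mult_self)
  have Kji: "K $$ (j, i) = star (K $$ (i, j))"
    using adj_index[of j K i] K ij by auto
  have "K' $$ (k, k) = (\<Sum>a<n. (adj ?G * K) $$ (k, a) * ?G $$ (a, k))"
    unfolding K'_def using G K k by (subst mult_mat_index[of _ n n]) auto
  also have "\<dots> = (\<Sum>a<n. (\<Sum>b<n. star (?G $$ (b, k)) * K $$ (b, a)) * ?G $$ (a, k))"
    using G K k
    by (intro sum.cong refl arg_cong2[where f = "(*)"])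
       (subst mult_mat_index[OF adj_carrier[OF G] K(1)], auto)
  finally have e: "K' $$ (k, k) = (\<Sum>a<n. (\<Sum>b<n. star (?G $$ (b, k)) * K $$ (b, a)) * ?G $$ (a, k))" .
  have conj: "QRe (star q * (K $$ (j, j) * q)) = QRe (K $$ (j, j))"
    "QRe (q * (K $$ (i, i) * star q)) = QRe (K $$ (i, i))"
    "QRe (star q * star (K $$ (i, j))) = QRe (K $$ (i, j) * q)"
    "QRe (star (K $$ (i, j)) * star q) = QRe (K $$ (i, j) * q)"
    "QRe (q * K $$ (i, j)) = QRe (K $$ (i, j) * q)"
    using qq
    by (metis QRe_commute mult.assoc mult.right_neutral star_mult star_quat_sel(1))+
  show ?thesis
  proof (cases "k = i \<or> k = j")
    case True
    have *: "(\<Sum>b<n. star (?G $$ (b, k)) * K $$ (b, a))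
        = star (?G $$ (i, k)) * K $$ (i, a) + star (?G $$ (j, k)) * K $$ (j, a)" if "a < n" for a
      using ij k True that by (intro sum_eq_two) (auto simp: plane_rotation_def)
    have "K' $$ (k, k) = (\<Sum>b<n. star (?G $$ (b, k)) * K $$ (b, i)) * ?G $$ (i, k)
        + (\<Sum>b<n. star (?G $$ (b, k)) * K $$ (b, j)) * ?G $$ (j, k)"
      unfolding e using ij k True by (intro sum_eq_two) (auto simp: plane_rotation_def)
    also have "\<dots> = (star (?G $$ (i, k)) * K $$ (i, i) + star (?G $$ (j, k)) * K $$ (j, i)) * ?G $$ (i, k)
        + (star (?G $$ (i, k)) * K $$ (i, j) + star (?G $$ (j, k)) * K $$ (j, j)) * ?G $$ (j, k)"
      using * ij by simp
    finally have **: "QRe (K' $$ (k, k)) = QRe \<dots>" by simp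
    show ?thesis
      using True
    proof
      assume "k = i"
      then show ?thesis
        using ij unfolding **
        by (simp add: plane_rotation_def Kji \<rho>_def conj power2_eq_square algebra_simps
            del: times_quat.sel)
    next
      assume "k = j"
      then show ?thesis
        using ij unfolding **
        by (simp add: plane_rotation_def Kji \<rho>_def conj power2_eq_square star_minus algebra_simps
            del: times_quat.sel)
    qed
  next
    case False
    have "(\<Sum>b<n. star (?G $$ (b, k)) * K $$ (b, a)) = K $$ (k, a)" if "a < n" for a
    proof -
      have "(\<Sum>b<n. star (?G $$ (b, k)) * K $$ (b, a)) = star (?G $$ (k, k)) * K $$ (k, a)"
        using ij k False that by (intro sum_eq_one) (auto simp: plane_rotation_def)
      then show ?thesis using False k by (simp add: plane_rotation_def)
    qed
    then have "K' $$ (k, k) = (\<Sum>a<n. K $$ (k, a) * ?G $$ (a, k))"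
      unfolding e by simp
    also have "\<dots> = K $$ (k, k) * ?G $$ (k, k)"
      using ij k False by (intro sum_eq_one) (auto simp: plane_rotation_def)
    finally show ?thesis using False k by (simp add: plane_rotation_def)
  qed
qed

lemma block_unitary_mult:
  assumes "U \<in> block_unitary n \<gamma>" "V \<in> block_unitary n \<gamma>"
  shows "U * V \<in> block_unitary n \<gamma>"
proof -
  have U: "U \<in> carrier_mat n n" "V \<in> carrier_mat n n" "unitary_mat n (U * V)"
    using assms by (auto simp: block_unitary_def unitary_matD unitary_mat_mult)
  have "(U * V) $$ (i, j) = 0" if "i < n" "j < n" "\<gamma> i \<noteq> \<gamma> j" for i j
  proof -
    have "U $$ (i, l) * V $$ (l, j) = 0" if "l < n" for l
      using assms \<open>i < n\<close> \<open>j < n\<close> \<open>\<gamma> i \<noteq> \<gamma> j\<close> that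
      by (cases "\<gamma> i = \<gamma> l") (auto simp: block_unitary_def)
    then show ?thesis
      using that by (subst mult_mat_index[OF U(1,2)]) auto
  qed
  then show ?thesis
    using U by (auto simp: block_unitary_def)
qed

text \<open>The expression is the gain of the \<open>i\<close>-th diagonal entry under a rotation: a quarter turn shows that
  \<open>\<Delta>\<close> cannot be positive, a small turn that \<open>\<rho>\<close> cannot.\<close>

lemma rotation_gain_nonpos:
  fixes \<Delta> \<rho> :: real
  assumes "\<And>c s. c\<^sup>2 + s\<^sup>2 = 1 \<Longrightarrow> s\<^sup>2 * \<Delta> + 2 * c * s * \<rho> \<le> 0"
  shows "\<Delta> \<le> 0" "\<rho> \<le> 0"
proof -
  show \<Delta>: "\<Delta> \<le> 0" using assms[of 0 1] by simp
  show "\<rho> \<le> 0"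
  proof (rule ccontr)
    assume "\<not> \<rho> \<le> 0"
    \<comment> \<open>\<open>t\<close> is the tangent of an angle so small that the linear term \<open>2t\<rho>\<close> outweighs \<open>t\<^sup>2\<Delta>\<close>\<close>
    define t where "t = \<rho> / (1 - \<Delta>)"
    have t: "t > 0" "t * (1 - \<Delta>) = \<rho>"
      using \<Delta> \<open>\<not> \<rho> \<le> 0\<close> by (auto simp: t_def)
    define c where "c = 1 / sqrt (1 + t\<^sup>2)"
    have pos: "1 + t\<^sup>2 > 0" by (simp add: add_pos_nonneg)
    have c: "c > 0" using pos by (simp add: c_def)
    have "c\<^sup>2 = 1 / (1 + t\<^sup>2)" using pos by (simp add: c_def power_divide)
    then have "c\<^sup>2 + (t * c)\<^sup>2 = 1"
      using pos by (simp add: power_mult_distrib) (simp add: field_simps)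
    from assms[OF this] have "(t * c\<^sup>2) * (t * \<Delta> + 2 * \<rho>) \<le> 0"
      by (simp add: power2_eq_square algebra_simps)
    then have "t * \<Delta> + 2 * \<rho> \<le> 0"
      using t c by (simp add: mult_le_0_iff)
    moreover have "t * \<Delta> = t - \<rho>" using t by (simp add: algebra_simps)
    ultimately show False using t \<open>\<not> \<rho> \<le> 0\<close> by simp
  qed
qed

text \<open>Choose \<open>U\<close> in the group of \<open>\<gamma>\<close> so that the trace of \<open>U\<^sup>*HU\<close>, weighted with strictly decreasing weights, is
  maximal. If \<open>\<gamma>\<^sub>i = \<gamma>\<^sub>j\<close>, the plane rotations of \<open>i\<close> and \<open>j\<close> stay inside the group, and none of them
  increases the weighted trace. A quarter turn then shows that the diagonal is sorted, and a small turn
  that the entry at \<open>(i, j)\<close> vanishes. The entries between different values of \<open>\<gamma>\<close> vanish from the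
  start.\<close>

theorem quat_hermitian_diagonalisation:
  fixes H :: "quat mat" and \<gamma> :: "nat \<Rightarrow> real"
  assumes H: "H \<in> carrier_mat n n" "adj H = H"
    and supp: "\<And>i j. i < n \<Longrightarrow> j < n \<Longrightarrow> \<gamma> i \<noteq> \<gamma> j \<Longrightarrow> H $$ (i, j) = 0"
  obtains U h where "U \<in> block_unitary n \<gamma>" "adj U * H * U = mat_diag n (\<lambda>i. of_real (h i))"
    and "\<And>i j. i \<le> j \<Longrightarrow> j < n \<Longrightarrow> \<gamma> i = \<gamma> j \<Longrightarrow> h j \<le> h i"
proof -
  \<comment> \<open>any strictly decreasing weights would do\<close>
  define w where "w k = - real k" for k
  obtain U where U: "U \<in> block_unitary n \<gamma>"
    and max: "\<And>V. V \<in> block_unitary n \<gamma> \<Longrightarrow> (\<Sum>k<n. w k * QRe ((adj V * H * V) $$ (k, k)))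
      \<le> (\<Sum>k<n. w k * QRe ((adj U * H * U) $$ (k, k)))"
    using block_unitary_trace_attains_max[OF H(1)] by blast
  have uU: "unitary_mat n U" and Uc: "U \<in> carrier_mat n n"
    using U by (auto simp: block_unitary_def unitary_matD)
  define K where "K = adj U * H * U"
  have K: "K \<in> carrier_mat n n"
    unfolding K_def using Uc H(1) Uc by (rule sandwich_carrier)
  have adjK: "adj K = K"
  proof -
    have "adj K = adj U * adj (adj U * H)"
      unfolding K_def using Uc H by (intro adj_mult[of _ n n _ n]) auto
    also have "\<dots> = adj U * (H * U)"
      using Uc H by (simp add: adj_mult[of _ n n _ n])
    finally show ?thesis
      using Uc H by (simp add: K_def assoc_mult_mat[of _ n n _ n _ n])
  qed
  have *: "QRe (K $$ (j, j)) \<le> QRe (K $$ (i, i)) \<and> K $$ (i, j) = 0"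
    if ij: "i < j" "j < n" "\<gamma> i = \<gamma> j" for i j
  proof -
    obtain q where q: "qnorm2 q = 1" "QRe (K $$ (i, j) * q) = sqrt (qnorm2 (K $$ (i, j)))"
      by (rule quat_unit_multiplier)
    define \<Delta> where "\<Delta> = QRe (K $$ (j, j)) - QRe (K $$ (i, i))"
    define \<rho> where "\<rho> = QRe (K $$ (i, j) * q)"
    have "s\<^sup>2 * \<Delta> + 2 * c * s * \<rho> \<le> 0" if cs: "c\<^sup>2 + s\<^sup>2 = 1" for c s
    proof -
      define G where "G = plane_rotation n i j c s q"
      have G: "unitary_mat n G" unfolding G_def
        using ij cs q by (intro unitary_plane_rotation) auto
      have "G \<in> block_unitary n \<gamma>"
        using G ij by (auto simp: block_unitary_def G_def plane_rotation_def)
      then have "U * G \<in> block_unitary n \<gamma>" by (rule block_unitary_mult[OF U])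
      moreover have "adj (U * G) * H * (U * G) = adj G * K * G"
        unfolding K_def using Uc H unitary_matD[OF G] by (intro adj_mult_sandwich) auto
      ultimately have "(\<Sum>k<n. w k * QRe ((adj G * K * G) $$ (k, k))) \<le> (\<Sum>k<n. w k * QRe (K $$ (k, k)))"
        using max[of "U * G"] by (simp add: K_def)
      then have "(\<Sum>k<n. w k * (QRe ((adj G * K * G) $$ (k, k)) - QRe (K $$ (k, k)))) \<le> 0"
        by (simp add: right_diff_distrib sum_subtractf)
      also have "(\<Sum>k<n. w k * (QRe ((adj G * K * G) $$ (k, k)) - QRe (K $$ (k, k))))
        = w i * (QRe ((adj G * K * G) $$ (i, i)) - QRe (K $$ (i, i)))
          + w j * (QRe ((adj G * K * G) $$ (j, j)) - QRe (K $$ (j, j)))"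
        using ij q unfolding G_def
        by (intro sum_eq_two) (auto simp: plane_rotation_diagonal[OF _ _ _ _ K adjK])
      also have "\<dots> = w i * ((c\<^sup>2 - 1) * QRe (K $$ (i, i)) + s\<^sup>2 * QRe (K $$ (j, j)) + 2 * c * s * \<rho>)
          + w j * (s\<^sup>2 * QRe (K $$ (i, i)) + (c\<^sup>2 - 1) * QRe (K $$ (j, j)) - 2 * c * s * \<rho>)"
        using ij q unfolding G_def \<rho>_def
        by (simp add: plane_rotation_diagonal[OF _ _ _ _ K adjK] algebra_simps)
      also have "c\<^sup>2 - 1 = - (s\<^sup>2)" using cs by simp
      finally have "(w i - w j) * (s\<^sup>2 * \<Delta> + 2 * c * s * \<rho>) \<le> 0"
        by (simp add: \<Delta>_def algebra_simps)
      moreover have "w i - w j > 0" using ij by (simp add: w_def)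
      ultimately show ?thesis by (simp add: mult_le_0_iff)
    qed
    from rotation_gain_nonpos[OF this] have "\<Delta> \<le> 0" "\<rho> \<le> 0" by auto
    then have "sqrt (qnorm2 (K $$ (i, j))) \<le> 0"
      unfolding \<rho>_def q(2) by simp
    then have "qnorm2 (K $$ (i, j)) = 0"
      using qnorm2_nonneg[of "K $$ (i, j)"] by (simp del: qnorm2_nonneg)
    then show ?thesis
      using \<open>\<Delta> \<le> 0\<close> by (simp add: \<Delta>_def)
  qed
  have off: "K $$ (i, j) = 0" if ij: "i < n" "j < n" "i \<noteq> j" for i j
  proof (cases "\<gamma> i = \<gamma> j")
    case True
    have "K $$ (j, i) = star (K $$ (i, j))"
      using adj_index[of j K i] K ij adjK by auto
    then show ?thesis
      using *[of i j] *[of j i] ij True by (cases "i < j") auto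
  next
    case False
    have "(adj U * H) $$ (i, b) * U $$ (b, j) = 0" if b: "b < n" for b
    proof (cases "\<gamma> b = \<gamma> j")
      case True
      have "star (U $$ (a, i)) * H $$ (a, b) = 0" if "a < n" for a
        using U supp[of a b] that b ij False True
        by (cases "\<gamma> a = \<gamma> i") (auto simp: block_unitary_def)
      then have "(adj U * H) $$ (i, b) = 0"
        using Uc ij b by (subst mult_mat_index[OF adj_carrier[OF Uc] H(1)]) auto
      then show ?thesis by simp
    qed (use U b ij in \<open>auto simp: block_unitary_def\<close>)
    then show ?thesis
      unfolding K_def using Uc H ij by (subst mult_mat_index[of _ n n]) auto
  qed
  show ?thesis
  proof (rule that[OF U, of "\<lambda>i. QRe (K $$ (i, i))"])
    have "K $$ (i, i) = of_real (QRe (K $$ (i, i)))" if "i < n" for i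
      using adj_index[of i K i] K that adjK by (intro self_star_quat) auto
    then show "adj U * H * U = mat_diag n (\<lambda>i. of_real (QRe (K $$ (i, i))))"
      using off K by (fold K_def, intro eq_matI) (auto simp: mat_diag_def)
    fix i j assume "i \<le> j" "j < n" "\<gamma> i = \<gamma> j"
    then show "QRe (K $$ (j, j)) \<le> QRe (K $$ (i, i))"
      using *[of i j] by (cases "i = j") auto
  qed
qed

section \<open>Diagonal matrices of dual numbers\<close>

lemma dq_of_dual_mult: "dq_of_dual (x * y) = dq_of_dual x * dq_of_dual y"
  by (auto simp: dual_eq_iff dual.map_sel)

lemma dq_of_dual_simps [simp]: "dq_of_dual 0 = 0" "dq_of_dual 1 = 1"
  by (auto simp: dual_eq_iff dual.map_sel)

lemma dq_of_dual_eq_iff: "dq_of_dual x = dq_of_dual y \<longleftrightarrow> x = y"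
  by (auto simp: dual_eq_iff dual.map_sel)

lemma star_of_real [simp]: "star (of_real a :: quat) = of_real a"
  by (simp add: quat_eq_iff)

lemma star_dq_of_dual [simp]: "star (dq_of_dual x) = dq_of_dual x"
  by (auto simp: dual_eq_iff dual.map_sel)

lemma dq_diag_carrier [simp]: "dq_diag n f \<in> carrier_mat n n"
  by (simp add: dq_diag_def)

lemma dq_diag_dim [simp]: "dim_row (dq_diag n f) = n" "dim_col (dq_diag n f) = n"
  by (rule carrier_matD[OF dq_diag_carrier])+

lemma dq_diag_mult: "dq_diag n f * dq_diag n g = dq_diag n (\<lambda>i. f i * g i)"
  by (simp add: dq_diag_def dq_of_dual_mult)

lemma adj_dq_diag: "adj (dq_diag n f) = dq_diag n f"
  by (simp add: dq_diag_def adj_mat_diag)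

lemma dq_diag_cong: "(\<And>i. i < n \<Longrightarrow> f i = g i) \<Longrightarrow> dq_diag n f = dq_diag n g"
  by (rule eq_matI) (auto simp: dq_diag_def mat_diag_def)

lemma dq_diag_inject:
  assumes "dq_diag n f = dq_diag n g" "i < n"
  shows "f i = g i"
proof -
  have "dq_diag n f $$ (i, i) = dq_diag n g $$ (i, i)" using assms by simp
  then show ?thesis using assms(2) by (simp add: dq_diag_def mat_diag_def dq_of_dual_eq_iff)
qed

lemma dq_diag_one: "dq_diag n (\<lambda>_. 1) = 1\<^sub>m n"
  by (simp add: dq_diag_def)

lemma dq_diag_zero: "dq_diag n (\<lambda>_. 0) = 0\<^sub>m n n"
  by (rule eq_matI) (auto simp: dq_diag_def mat_diag_def)

lemma dq_diag_add: "dq_diag (k + l) f = dq_diag k f \<oplus>\<^sub>m dq_diag l (\<lambda>i. f (k + i))"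
  by (simp add: dq_diag_def mat_diag_add)

lemma dq_diag_eps_carrier [simp]: "dq_diag_eps k f \<in> carrier_mat k k"
  by (simp add: dq_diag_eps_def)

lemma dq_diag_eps_dim [simp]: "dim_row (dq_diag_eps k f) = k" "dim_col (dq_diag_eps k f) = k"
  by (simp_all add: dq_diag_eps_def)

lemma adj_dq_diag_eps: "adj (dq_diag_eps k f) = dq_diag_eps k f"
  by (simp add: dq_diag_eps_def adj_dq_diag)

lemma dq_diag_eps_mult: "dq_diag_eps k f * dq_diag_eps k g = 0\<^sub>m k k"
  unfolding dq_diag_eps_def dq_diag_mult dq_diag_zero[symmetric]
  by (rule dq_diag_cong) (simp add: dual_eq_iff)

section \<open>Standard and infinitesimal parts of matrices\<close>

abbreviation std_mat :: "'a dual mat \<Rightarrow> 'a mat" where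
  "std_mat \<equiv> map_mat std_part"

abbreviation inf_mat :: "'a dual mat \<Rightarrow> 'a mat" where
  "inf_mat \<equiv> map_mat inf_part"

definition dual_mat :: "'a mat \<Rightarrow> 'a mat \<Rightarrow> 'a dual mat" where
  "dual_mat A B = mat (dim_row A) (dim_col A) (\<lambda>ij. Dual (A $$ ij) (B $$ ij))"

lemma dual_mat_carrier [simp, intro]: "A \<in> carrier_mat m n \<Longrightarrow> dual_mat A B \<in> carrier_mat m n"
  by (simp add: dual_mat_def)

lemma std_mat_dual_mat [simp]: "std_mat (dual_mat A B) = A"
  by (rule eq_matI) (auto simp: dual_mat_def)

lemma inf_mat_dual_mat:
  "A \<in> carrier_mat m n \<Longrightarrow> B \<in> carrier_mat m n \<Longrightarrow> inf_mat (dual_mat A B) = B"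
  by (rule eq_matI) (auto simp: dual_mat_def)

lemma dual_mat_eqI:
  assumes "A \<in> carrier_mat m n" "B \<in> carrier_mat m n"
    and "std_mat A = std_mat B" "inf_mat A = inf_mat B"
  shows "A = B"
proof (rule eq_matI)
  fix i j assume ij: "i < dim_row B" "j < dim_col B"
  have "std_mat A $$ (i, j) = std_mat B $$ (i, j)" "inf_mat A $$ (i, j) = inf_mat B $$ (i, j)"
    using assms by simp_all
  then show "A $$ (i, j) = B $$ (i, j)"
    using assms(1,2) ij by (auto simp: dual_eq_iff)
qed (use assms in auto)

lemma dual_sum_sel:
  "std_part (sum f A) = (\<Sum>i\<in>A. std_part (f i))" "inf_part (sum f A) = (\<Sum>i\<in>A. inf_part (f i))"
  by (induction A rule: infinite_finite_induct; simp)+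

lemma std_mat_mult:
  assumes "A \<in> carrier_mat m n" "B \<in> carrier_mat n k"
  shows "std_mat (A * B :: 'a::ring_1 dual mat) = std_mat A * std_mat B"
proof (rule eq_matI)
  fix i j assume "i < dim_row (std_mat A * std_mat B)" "j < dim_col (std_mat A * std_mat B)"
  then have ij: "i < m" "j < k" using assms by auto
  have "std_mat (A * B) $$ (i, j) = std_part ((A * B) $$ (i, j))"
    using assms ij by simp
  also have "\<dots> = (\<Sum>l<n. std_mat A $$ (i, l) * std_mat B $$ (l, j))"
    using assms ij unfolding mult_mat_index[OF assms ij] by (simp add: dual_sum_sel)
  also have "\<dots> = (std_mat A * std_mat B) $$ (i, j)"
    using assms ij by (intro mult_mat_index[symmetric]) auto
  finally show "std_mat (A * B) $$ (i, j) = (std_mat A * std_mat B) $$ (i, j)" .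
qed (use assms in auto)

lemma inf_mat_mult:
  assumes "A \<in> carrier_mat m n" "B \<in> carrier_mat n k"
  shows "inf_mat (A * B :: 'a::ring_1 dual mat) = std_mat A * inf_mat B + inf_mat A * std_mat B"
proof (rule eq_matI)
  fix i j assume "i < dim_row (std_mat A * inf_mat B + inf_mat A * std_mat B)"
    "j < dim_col (std_mat A * inf_mat B + inf_mat A * std_mat B)"
  then have ij: "i < m" "j < k" using assms by auto
  have c: "std_mat A \<in> carrier_mat m n" "inf_mat A \<in> carrier_mat m n"
    "std_mat B \<in> carrier_mat n k" "inf_mat B \<in> carrier_mat n k" using assms by auto
  have "inf_mat (A * B) $$ (i, j) = inf_part ((A * B) $$ (i, j))"
    using assms ij by simp
  also have "\<dots> = (\<Sum>l<n. std_mat A $$ (i, l) * inf_mat B $$ (l, j))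
      + (\<Sum>l<n. inf_mat A $$ (i, l) * std_mat B $$ (l, j))"
    using assms ij unfolding mult_mat_index[OF assms ij]
    by (simp add: dual_sum_sel sum.distrib)
  also have "\<dots> = (std_mat A * inf_mat B) $$ (i, j) + (inf_mat A * std_mat B) $$ (i, j)"
    using mult_mat_index[OF c(1,4) ij] mult_mat_index[OF c(2,3) ij] by simp
  also have "\<dots> = (std_mat A * inf_mat B + inf_mat A * std_mat B) $$ (i, j)"
    using assms ij by simp
  finally show "inf_mat (A * B) $$ (i, j)
    = (std_mat A * inf_mat B + inf_mat A * std_mat B) $$ (i, j)" .
qed (use assms in auto)

lemma dual_mat_mult:
  assumes "A \<in> carrier_mat m n" "B \<in> carrier_mat n k" "A' \<in> carrier_mat m n" "B' \<in> carrier_mat n k"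
  shows "dual_mat A A' * dual_mat B B' = dual_mat (A * B) (A * B' + A' * (B :: 'a::ring_1 mat))"
proof (rule dual_mat_eqI[of _ m k])
  have c: "dual_mat A A' \<in> carrier_mat m n" "dual_mat B B' \<in> carrier_mat n k" using assms by auto
  have c': "A * B \<in> carrier_mat m k" "A * B' + A' * B \<in> carrier_mat m k" using assms by auto
  show "dual_mat A A' * dual_mat B B' \<in> carrier_mat m k" using c by (rule mult_carrier_mat)
  show "dual_mat (A * B) (A * B' + A' * B) \<in> carrier_mat m k" using c' by auto
  show "std_mat (dual_mat A A' * dual_mat B B') = std_mat (dual_mat (A * B) (A * B' + A' * B))"
    using std_mat_mult[OF c] by simp
  show "inf_mat (dual_mat A A' * dual_mat B B') = inf_mat (dual_mat (A * B) (A * B' + A' * B))"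
    using inf_mat_mult[OF c] assms c'
    by (simp add: inf_mat_dual_mat[of A m n] inf_mat_dual_mat[of B n k] inf_mat_dual_mat[of "A * B" m k])
qed

lemma dual_mat_std_inf: "dual_mat (std_mat A) (inf_mat A) = A"
  by (rule eq_matI) (auto simp: dual_mat_def)

lemma adj_dual_mat:
  assumes "A \<in> carrier_mat m n" "B \<in> carrier_mat m n"
  shows "adj (dual_mat A B) = dual_mat (adj A) (adj B)"
  by (rule eq_matI) (use assms in \<open>auto simp: dual_mat_def dual_eq_iff\<close>)

lemma std_mat_adj: "std_mat (adj A) = adj (std_mat A)"
  by (rule eq_matI) auto

lemma inf_mat_adj: "inf_mat (adj A) = adj (inf_mat A)"
  by (rule eq_matI) auto

lemma dual_mat_one: "dual_mat (1\<^sub>m n) (0\<^sub>m n n) = 1\<^sub>m n"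
  by (rule eq_matI) (auto simp: dual_mat_def dual_eq_iff)

lemma dual_mat_sandwich:
  assumes "U \<in> carrier_mat m n" "A \<in> carrier_mat m p" "A' \<in> carrier_mat m p" "V \<in> carrier_mat p q"
  shows "adj (dual_mat U (0\<^sub>m m n)) * dual_mat A A' * dual_mat V (0\<^sub>m p q)
    = dual_mat (adj U * A * V) (adj U * A' * (V :: 'a::star_ring mat))"
proof -
  have c: "adj U \<in> carrier_mat n m" using assms by auto
  have c2: "adj U * A \<in> carrier_mat n p" "adj U * A' \<in> carrier_mat n p"
    using c assms(2) by (rule mult_carrier_mat, use c assms(3) in \<open>rule mult_carrier_mat\<close>)
  have c3: "adj U * A' * V \<in> carrier_mat n q"
    using c2(2) assms(4) by (rule mult_carrier_mat)
  have "adj (dual_mat U (0\<^sub>m m n)) * dual_mat A A' = dual_mat (adj U * A) (adj U * A' + 0\<^sub>m n m * A)"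
    using assms c by (simp add: adj_dual_mat[of U m n] dual_mat_mult[of _ n m _ p])
  also have "\<dots> = dual_mat (adj U * A) (adj U * A')"
    using assms c2 by simp
  finally have "adj (dual_mat U (0\<^sub>m m n)) * dual_mat A A' * dual_mat V (0\<^sub>m p q)
      = dual_mat (adj U * A * V) (adj U * A * 0\<^sub>m p q + adj U * A' * V)"
    using assms c2 by (simp add: dual_mat_mult[of _ n p _ q])
  also have "\<dots> = dual_mat (adj U * A * V) (adj U * A' * V)"
    using right_mult_zero_mat[OF c2(1)] left_add_zero_mat[OF c3] by simp
  finally show ?thesis .
qed

lemma unitary_dual_mat:
  assumes "unitary_mat n U"
  shows "unitary_mat n (dual_mat U (0\<^sub>m n n))"
proof -
  note U = unitary_matD[OF assms]
  show ?thesis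
    using U by (auto simp: unitary_mat_def adj_dual_mat[of _ n n] dual_mat_mult[of _ n n _ n] dual_mat_one)
qed

text \<open>The tangent space of the unitary group at the identity consists of the skew-Hermitian
  matrices. Since \<open>\<epsilon>\<^sup>2 = 0\<close>, the first order term of the exponential is all of it.\<close>

lemma unitary_infinitesimal_rotation:
  assumes "Q \<in> carrier_mat n n" "adj Q = - (Q :: 'a::star_ring mat)"
  shows "unitary_mat n (dual_mat (1\<^sub>m n) Q)"
proof -
  have "Q + - Q = 0\<^sub>m n n" "- Q + Q = 0\<^sub>m n n" using assms by auto
  then show ?thesis
    using assms
    by (auto simp: unitary_mat_def adj_dual_mat[of _ n n] dual_mat_mult[of _ n n _ n] dual_mat_one)
qed

lemma dq_diag_eq_dual_mat:
  "dq_diag n f = dual_mat (mat_diag n (\<lambda>i. of_real (std_part (f i)))) (mat_diag n (\<lambda>i. of_real (inf_part (f i))))"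
  by (rule eq_matI) (auto simp: dq_diag_def dual_mat_def mat_diag_def dual_eq_iff dual.map_sel)

lemma dual_leI:
  "std_part x \<le> std_part y \<Longrightarrow> (std_part x = std_part y \<Longrightarrow> inf_part x \<le> inf_part y) \<Longrightarrow> x \<le> y"
  by (cases "std_part x = std_part y"; cases "inf_part x = inf_part y")
     (auto simp: less_eq_dual_def less_dual_def dual_eq_iff)

lemma adj_sandwich:
  assumes "A \<in> carrier_mat m m" "U \<in> carrier_mat m n"
  shows "adj (adj U * A * U) = adj U * adj A * U"
proof -
  have c: "adj U \<in> carrier_mat n m" using assms by auto
  have c2: "adj U * A \<in> carrier_mat n m" using c assms(1) by (rule mult_carrier_mat)
  have "adj (adj U * A * U) = adj U * (adj A * adj (adj U))"
    unfolding adj_mult[OF c2 assms(2)] adj_mult[OF c assms(1)] ..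
  also have "\<dots> = adj U * (adj A * U)" by simp
  also have "\<dots> = adj U * adj A * U"
    using c assms by (intro assoc_mult_mat[symmetric, of _ n m _ m _ n]) auto
  finally show ?thesis .
qed

section \<open>Diagonalisation of dual quaternion Hermitian matrices\<close>

text \<open>This is first order perturbation theory, made exact by \<open>\<epsilon>\<^sup>2 = 0\<close>: the standard part gives the
  unperturbed eigenvalues \<open>\<mu>\<^sub>i\<close>, a rotation \<open>I + Q\<epsilon>\<close> decouples different eigenvalues, and the perturbation
  is diagonalised in each eigenspace, where it gives the infinitesimal parts. Both real quaternion
  diagonalisations sort their result, the second one within each group of equal \<open>\<mu>\<^sub>i\<close>, so the dual
  eigenvalues come out in lexicographic order.\<close>

theorem dual_quat_hermitian_diagonalisation:
  assumes H: "H \<in> carrier_mat n n" "adj H = H"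
  obtains U f where "unitary_mat n U" "adj U * H * U = dq_diag n f"
    and "\<And>i j. i \<le> j \<Longrightarrow> j < n \<Longrightarrow> f j \<le> f i"
proof -
  define H0 where "H0 = std_mat H"
  define H1 where "H1 = inf_mat H"
  have H0: "H0 \<in> carrier_mat n n" "adj H0 = H0" and H1: "H1 \<in> carrier_mat n n" "adj H1 = H1"
    using H std_mat_adj[of H] inf_mat_adj[of H] by (auto simp: H0_def H1_def)
  obtain U0 \<mu> where "U0 \<in> block_unitary n (\<lambda>_. 0)"
    and U0_diag: "adj U0 * H0 * U0 = mat_diag n (\<lambda>i. of_real (\<mu> i))"
    and mono: "\<And>i j. i \<le> j \<Longrightarrow> j < n \<Longrightarrow> \<mu> j \<le> \<mu> i"
    using quat_hermitian_diagonalisation[of H0 n "\<lambda>_. 0"] H0 by auto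
  then have U0: "unitary_mat n U0" by (simp add: block_unitary_def)
  define \<Lambda> :: "quat mat" where "\<Lambda> = mat_diag n (\<lambda>i. of_real (\<mu> i))"
  define K where "K = adj U0 * H1 * U0"
  have \<Lambda>: "\<Lambda> \<in> carrier_mat n n" by (simp add: \<Lambda>_def)
  have K: "K \<in> carrier_mat n n"
    unfolding K_def by (intro sandwich_carrier) (use unitary_matD[OF U0] H1 in auto)
  have adjK: "adj K = K"
    unfolding K_def adj_sandwich[OF H1(1) unitary_matD(1)[OF U0]] H1(2) ..
  define X where "X = dual_mat U0 (0\<^sub>m n n)"
  have X: "unitary_mat n X" unfolding X_def by (rule unitary_dual_mat[OF U0])
  have X_H: "adj X * H * X = dual_mat \<Lambda> K"
  proof -
    have "H = dual_mat H0 H1" by (simp add: H0_def H1_def dual_mat_std_inf)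
    then show ?thesis
      using unitary_matD[OF U0] H0 H1
      by (simp add: X_def K_def \<Lambda>_def U0_diag[symmetric] dual_mat_sandwich[of U0 n n _ n _ _ n])
  qed
  \<comment> \<open>Conjugation by \<open>1 + Q\<epsilon>\<close> adds the commutator of \<open>\<Lambda>\<close> and \<open>Q\<close> to the infinitesimal part,
    which suffices to remove all its entries between different eigenvalues.\<close>
  define Q where "Q = mat n n (\<lambda>(i, j). if \<mu> i = \<mu> j then 0 else (1 / (\<mu> j - \<mu> i)) *\<^sub>R K $$ (i, j))"
  have Q: "Q \<in> carrier_mat n n" by (simp add: Q_def)
  have Kji: "star (K $$ (j, i)) = K $$ (i, j)" if "i < n" "j < n" for i j
    using adj_index[of i K j] K adjK that by auto
  have adjQ: "adj Q = - Q"
  proof (rule eq_matI)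
    fix i j assume "i < dim_row (- Q)" "j < dim_col (- Q)"
    then have ij: "i < n" "j < n" by (auto simp: Q_def)
    have "1 / (\<mu> i - \<mu> j) = - (1 / (\<mu> j - \<mu> i))"
      by (metis minus_diff_eq minus_divide_right)
    then show "adj Q $$ (i, j) = (- Q) $$ (i, j)"
      using ij Kji[of i j] by (auto simp: Q_def star_minus)
  qed (auto simp: Q_def)
  define T where "T = dual_mat (1\<^sub>m n) Q"
  have T: "unitary_mat n T" unfolding T_def by (rule unitary_infinitesimal_rotation[OF Q adjQ])
  define K' where "K' = mat n n (\<lambda>(i, j). if \<mu> i = \<mu> j then K $$ (i, j) else 0)"
  have K': "K' \<in> carrier_mat n n" by (simp add: K'_def)
  have adjK': "adj K' = K'"
    by (rule eq_matI) (use Kji in \<open>auto simp: K'_def\<close>)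
  have T_H: "adj T * dual_mat \<Lambda> K * T = dual_mat \<Lambda> K'"
  proof -
    have mQ: "- Q \<in> carrier_mat n n" using Q by simp
    have c: "K + - Q * \<Lambda> \<in> carrier_mat n n" using K Q \<Lambda> by simp
    have "adj T * dual_mat \<Lambda> K = dual_mat \<Lambda> (K + - Q * \<Lambda>)"
      using Q \<Lambda> K mQ
      by (simp add: T_def adj_dual_mat[of _ n n] adjQ dual_mat_mult[of "1\<^sub>m n" n n \<Lambda> n])
    then have "adj T * dual_mat \<Lambda> K * T = dual_mat \<Lambda> (\<Lambda> * Q + (K + - Q * \<Lambda>))"
      using Q \<Lambda> c
      by (simp add: T_def dual_mat_mult[of \<Lambda> n n "1\<^sub>m n" n] del: uminus_mult_left_mat)
    also have "\<Lambda> * Q + (K + - Q * \<Lambda>) = K'"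
    proof (rule eq_matI)
      fix i j assume "i < dim_row K'" "j < dim_col K'"
      then have ij: "i < n" "j < n" by (auto simp: K'_def)
      have 1: "(\<Lambda> * Q) $$ (i, j) = \<mu> i *\<^sub>R Q $$ (i, j)"
        unfolding \<Lambda>_def mat_diag_mult_left[OF Q] using ij by (simp add: of_real_def)
      have 2: "(- Q * \<Lambda>) $$ (i, j) = - (\<mu> j *\<^sub>R Q $$ (i, j))"
        unfolding \<Lambda>_def mat_diag_mult_right[OF mQ] using ij Q by (simp add: of_real_def)
      have "(\<Lambda> * Q + (K + - Q * \<Lambda>)) $$ (i, j) = (\<Lambda> * Q) $$ (i, j) + (K $$ (i, j) + (- Q * \<Lambda>) $$ (i, j))"
        using ij K Q \<Lambda> by (simp del: uminus_mult_left_mat)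
      also have "\<dots> = K $$ (i, j) - (\<mu> j - \<mu> i) *\<^sub>R Q $$ (i, j)"
        unfolding 1 2 by (simp add: scaleR_diff_left)
      also have "\<dots> = K' $$ (i, j)"
        using ij by (auto simp: Q_def K'_def)
      finally show "(\<Lambda> * Q + (K + - Q * \<Lambda>)) $$ (i, j) = K' $$ (i, j)" .
    qed (use K Q \<Lambda> in \<open>auto simp: K'_def\<close>)
    finally show ?thesis .
  qed
  obtain U1 h where U1b: "U1 \<in> block_unitary n \<mu>"
    and U1_diag: "adj U1 * K' * U1 = mat_diag n (\<lambda>i. of_real (h i))"
    and mono': "\<And>i j. i \<le> j \<Longrightarrow> j < n \<Longrightarrow> \<mu> i = \<mu> j \<Longrightarrow> h j \<le> h i"
    using quat_hermitian_diagonalisation[OF K' adjK', of \<mu>] by (auto simp: K'_def)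
  have U1: "unitary_mat n U1" using U1b by (simp add: block_unitary_def)
  have U1_\<Lambda>: "adj U1 * \<Lambda> * U1 = \<Lambda>"
  proof -
    have "\<Lambda> * U1 = U1 * \<Lambda>"
      unfolding \<Lambda>_def mat_diag_mult_left[OF unitary_matD(1)[OF U1]]
        mat_diag_mult_right[OF unitary_matD(1)[OF U1]]
    proof (rule eq_matI, simp_all)
      fix i j assume "i < n" "j < n"
      then show "of_real (\<mu> i) * U1 $$ (i, j) = U1 $$ (i, j) * of_real (\<mu> j)"
        using U1b by (cases "\<mu> i = \<mu> j") (auto simp: block_unitary_def of_real_def)
    qed
    then have "adj U1 * \<Lambda> * U1 = adj U1 * (U1 * \<Lambda>)"
      using unitary_matD[OF U1] \<Lambda> by (simp add: assoc_mult_mat[of _ n n _ n _ n])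
    then show ?thesis using unitary_mult_cancel[OF U1 \<Lambda>] by simp
  qed
  define Y where "Y = dual_mat U1 (0\<^sub>m n n)"
  have Y: "unitary_mat n Y" unfolding Y_def by (rule unitary_dual_mat[OF U1])
  define f where "f i = Dual (\<mu> i) (h i)" for i
  have Y_H: "adj Y * dual_mat \<Lambda> K' * Y = dq_diag n f"
    using unitary_matD[OF U1] \<Lambda> K'
    by (simp add: Y_def dual_mat_sandwich[of U1 n n _ n _ _ n] U1_\<Lambda> U1_diag)
       (simp add: dq_diag_eq_dual_mat f_def \<Lambda>_def)
  note XYT = unitary_matD(1)[OF X] unitary_matD(1)[OF T] unitary_matD(1)[OF Y]
  show ?thesis
  proof (rule that)
    show "unitary_mat n (X * T * Y)"
      by (intro unitary_mat_mult X T Y)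
    have XT: "X * T \<in> carrier_mat n n" using XYT by simp
    show "adj (X * T * Y) * H * (X * T * Y) = dq_diag n f"
      unfolding adj_mult_sandwich[OF XT XYT(3) H(1) XT XYT(3)]
        adj_mult_sandwich[OF XYT(1,2) H(1) XYT(1,2)] X_H T_H Y_H ..
    fix i j assume "i \<le> j" "j < n"
    then show "f j \<le> f i"
      using mono[of i j] mono'[of i j] by (intro dual_leI) (auto simp: f_def)
  qed
qed

section \<open>Completion of orthonormal columns\<close>

text \<open>The trace of a product is not symmetric over the quaternions, but its real part is.\<close>

lemma trace_commute:
  assumes "A \<in> carrier_mat m n" "B \<in> carrier_mat n (m::nat)"
  shows "(\<Sum>i<m. QRe (std_part ((A * B) $$ (i, i)))) = (\<Sum>i<n. QRe (std_part ((B * A) $$ (i, i))))"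
proof -
  have "(\<Sum>i<m. QRe (std_part ((A * B) $$ (i, i))))
      = (\<Sum>i<m. \<Sum>l<n. QRe (std_part (A $$ (i, l)) * std_part (B $$ (l, i))))"
    by (intro sum.cong refl)
       (simp add: mult_mat_index[OF assms] dual_sum_sel quat_sum_sel del: times_quat.sel)
  also have "\<dots> = (\<Sum>i<m. \<Sum>l<n. QRe (std_part (B $$ (l, i)) * std_part (A $$ (i, l))))"
    by (simp only: QRe_commute)
  also have "\<dots> = (\<Sum>l<n. \<Sum>i<m. QRe (std_part (B $$ (l, i)) * std_part (A $$ (i, l))))"
    by (rule sum.swap)
  also have "\<dots> = (\<Sum>i<n. QRe (std_part ((B * A) $$ (i, i))))"
    by (intro sum.cong refl)
       (simp add: mult_mat_index[OF assms(2,1)] dual_sum_sel quat_sum_sel del: times_quat.sel)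
  finally show ?thesis .
qed

text \<open>The real parts of the traces of \<open>U\<^sup>*U\<close> and \<open>UU\<^sup>*\<close> agree; for identity matrices they are the sizes.\<close>

lemma unitary_dims_agree:
  fixes U :: "dual_quat mat"
  assumes "U \<in> carrier_mat m n" "adj U * U = 1\<^sub>m n" "U * adj U = 1\<^sub>m m"
  shows "m = n"
  using trace_commute[OF assms(1) adj_carrier[OF assms(1)]] assms by simp

lemma downward_closed_initial_segment:
  assumes "\<And>i j. i \<le> j \<Longrightarrow> j < n \<Longrightarrow> P j \<Longrightarrow> P i"
  shows "\<exists>a\<le>n. \<forall>i<n. P i \<longleftrightarrow> i < (a::nat)"
proof -
  define a where "a = (LEAST i. i = n \<or> \<not> P i)"
  have "a = n \<or> \<not> P a" unfolding a_def by (rule LeastI[of _ n]) simp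
  moreover have "a \<le> n" unfolding a_def by (rule Least_le) simp
  moreover have "P i" if "i < a" for i
    using not_less_Least[of i "\<lambda>i. i = n \<or> \<not> P i"] that by (simp add: a_def)
  ultimately show ?thesis
    using assms by (metis leI)
qed

lemma unitary_hcatI:
  assumes "B \<in> carrier_mat m k" "C \<in> carrier_mat m j" "m = k + j"
    and "adj B * B = 1\<^sub>m k" "adj B * C = 0\<^sub>m k j" "adj C * B = 0\<^sub>m j k" "adj C * C = 1\<^sub>m j"
    and "B * adj B + C * adj C = 1\<^sub>m m"
  shows "unitary_mat m (hcat B C)"
  using assms by (auto simp: unitary_mat_def adj_hcat_mult[OF assms(1,2,1,2)] hcat_mult_adj[OF assms(1,2,1,2)])

lemma dual_idempotent:
  assumes "x * x = (x :: real dual)"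
  shows "x = 0 \<or> x = 1"
  using assms by (auto simp: dual_eq_iff)

text \<open>The matrix \<open>P = I - BB\<^sup>*\<close> is Hermitian and idempotent. Dual numbers have only the idempotents \<open>0\<close> and
  \<open>1\<close>, so \<open>V\<^sup>*PV = diag(I, 0)\<close> for some unitary \<open>V\<close>, and the columns of \<open>V\<close> that belong to the eigenvalue
  \<open>1\<close> give \<open>P = CC\<^sup>*\<close>. They are orthogonal to \<open>B\<close> because \<open>B\<^sup>*P = 0\<close>.\<close>

theorem orthonormal_completion:
  fixes B :: "dual_quat mat"
  assumes B: "B \<in> carrier_mat m k" "adj B * B = 1\<^sub>m k"
  obtains C j where "C \<in> carrier_mat m j" "m = k + j"
    and "adj B * C = 0\<^sub>m k j" "adj C * B = 0\<^sub>m j k" "adj C * C = 1\<^sub>m j"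
    and "B * adj B + C * adj C = 1\<^sub>m m"
proof -
  have Ba: "adj B \<in> carrier_mat k m" using B by auto
  define N where "N = B * adj B"
  have N: "N \<in> carrier_mat m m" unfolding N_def using B(1) Ba by (rule mult_carrier_mat)
  define P where "P = 1\<^sub>m m - N"
  have P: "P \<in> carrier_mat m m" unfolding P_def by (rule minus_carrier_mat[OF N])
  have adjN: "adj N = N"
    unfolding N_def using adj_mult[OF B(1) Ba] by simp
  have adjP: "adj P = P"
  proof (rule eq_matI)
    fix i j assume "i < dim_row P" "j < dim_col P"
    then have ij: "i < m" "j < m" using P by auto
    have "star (N $$ (j, i)) = N $$ (i, j)"
      using adj_index[of i N j] ij N adjN by auto
    then show "adj P $$ (i, j) = P $$ (i, j)"
      using ij N P by (auto simp: P_def star_minus star_add[of _ "- _", simplified])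
  qed (use P in auto)
  have adjB_N: "adj B * N = adj B"
    unfolding N_def using isometry_mult_cancel[OF B(2,1) Ba] .
  have adjB_P: "adj B * P = 0\<^sub>m k m"
    unfolding P_def mult_minus_distrib_mat[OF Ba one_carrier_mat N] adjB_N right_mult_one_mat[OF Ba]
    by (rule minus_r_inv_mat[OF Ba])
  have "N * P = B * (adj B * P)"
    unfolding N_def using B Ba P by (intro assoc_mult_mat[of _ m k _ m _ m])
  then have N_P: "N * P = 0\<^sub>m m m"
    using adjB_P B by simp
  have PP: "P * P = P"
  proof -
    have "P * P = 1\<^sub>m m * P - N * P"
      unfolding P_def by (rule minus_mult_distrib_mat[of _ m m _ _ m]) (use N P P_def in auto)
    moreover have "P - 0\<^sub>m m m = P" using P by (intro eq_matI) auto
    ultimately show ?thesis using N_P P by simp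
  qed
  obtain V f where V: "unitary_mat m V" and V_P: "adj V * P * V = dq_diag m f"
    and mono: "\<And>i j. i \<le> j \<Longrightarrow> j < m \<Longrightarrow> f j \<le> f i"
    using dual_quat_hermitian_diagonalisation[OF P adjP] by blast
  note Vc = unitary_matD[OF V]
  have PV: "P * V = V * dq_diag m f"
  proof -
    have "V * dq_diag m f = V * (adj V * (P * V))"
      unfolding V_P[symmetric] using Vc P by (simp add: assoc_mult_mat[of _ m m _ m _ m])
    then show ?thesis using unitary_mult_cancel(2)[OF V, of "P * V" m] P Vc by simp
  qed
  have "f i = 0 \<or> f i = 1" if "i < m" for i
  proof -
    have "dq_diag m (\<lambda>i. f i * f i) = adj V * P * V * dq_diag m f"
      by (simp add: V_P dq_diag_mult)
    also have "\<dots> = adj V * P * (V * dq_diag m f)"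
      using Vc P by (intro assoc_mult_mat[of _ m m _ m _ m]) auto
    also have "\<dots> = adj V * P * (P * V)" by (simp add: PV)
    also have "\<dots> = adj V * P * P * V"
      using Vc P by (intro assoc_mult_mat[symmetric, of _ m m _ m _ m]) auto
    also have "adj V * P * P = adj V * P"
      using Vc P PP by (simp add: assoc_mult_mat[of _ m m _ m _ m])
    finally show ?thesis
      using dual_idempotent dq_diag_inject[OF _ that] V_P by auto
  qed
  then have f01: "f i \<in> {0, 1}" if "i < m" for i using that by auto
  have "f i = 1" if "i \<le> j" "j < m" "f j = 1" for i j
    using mono[of i j] f01[of i] that by (auto simp: less_eq_dual_def less_dual_def)
  then have "\<exists>j\<le>m. \<forall>i<m. f i = 1 \<longleftrightarrow> i < j"
    by (intro downward_closed_initial_segment) blast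
  then obtain j where j: "j \<le> m" "\<And>i. i < m \<Longrightarrow> f i = 1 \<longleftrightarrow> i < j" by blast
  define h where "h = m - j"
  have m: "m = j + h" using j by (simp add: h_def)
  have F: "dq_diag m f = 1\<^sub>m j \<oplus>\<^sub>m 0\<^sub>m h h"
  proof -
    have "dq_diag j f = 1\<^sub>m j"
      unfolding dq_diag_one[symmetric] by (rule dq_diag_cong) (use j m in auto)
    moreover have "dq_diag h (\<lambda>i. f (j + i)) = 0\<^sub>m h h"
      unfolding dq_diag_zero[symmetric]
    proof (rule dq_diag_cong)
      fix i assume "i < h"
      then show "f (j + i) = 0" using j(2)[of "j + i"] f01[of "j + i"] m by auto
    qed
    ultimately show ?thesis unfolding m dq_diag_add by simp
  qed
  obtain C C' where C: "C \<in> carrier_mat m j" "C' \<in> carrier_mat m h" "V = hcat C C'"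
    using hcat_split[of V m j h] Vc m by auto
  have "four_block_mat (adj C * C) (adj C * C') (adj C' * C) (adj C' * C')
      = four_block_mat (1\<^sub>m j) (0\<^sub>m j h) (0\<^sub>m h j) (1\<^sub>m h)"
    using Vc(3) adj_hcat_mult[OF C(1,2,1,2)] by (simp add: C(3) m)
  then have CC: "adj C * C = 1\<^sub>m j" "adj C' * C = 0\<^sub>m h j"
    by (rule four_block_mat_inject[of _ _ _ _ _ _ _ _ j j h h], use C in auto)+
  have PC: "P = C * adj C"
  proof -
    have "P = P * V * adj V"
      using P Vc by (simp add: assoc_mult_mat[of _ m m _ m _ m])
    also have "P * V = hcat C C' * (1\<^sub>m j \<oplus>\<^sub>m 0\<^sub>m h h)"
      using PV F C(3) by simp
    also have "\<dots> = hcat C (0\<^sub>m m h)"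
      using C by (simp add: hcat_mult_dsum[of _ m j _ h _ j _ h])
    also have "\<dots> * adj V = C * adj C"
      using C by (simp add: hcat_mult_adj[of _ m j _ h])
    finally show ?thesis .
  qed
  have "B * adj B + C * adj C = 1\<^sub>m m"
    unfolding PC[symmetric] N_def[symmetric] P_def by (rule eq_matI) (use N in auto)
  moreover have BC: "adj B * C = 0\<^sub>m k j"
  proof -
    have "C = P * C"
      unfolding PC using C CC Ba by (simp add: assoc_mult_mat[of _ m j _ m _ j])
    then have "adj B * C = adj B * P * C"
      using Ba P C by (simp add: assoc_mult_mat[of _ k m _ m _ j])
    then show ?thesis using adjB_P C by simp
  qed
  moreover have CB: "adj C * B = 0\<^sub>m j k"
    using arg_cong[OF BC, of adj] adj_mult[OF Ba C(1)] by simp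
  moreover have "m = k + j"
  proof (rule unitary_dims_agree)
    show "hcat B C \<in> carrier_mat m (k + j)" using B C by auto
    show "adj (hcat B C) * hcat B C = 1\<^sub>m (k + j)"
      using adj_hcat_mult[OF B(1) C(1) B(1) C(1)] B CC BC CB by simp
    show "hcat B C * adj (hcat B C) = 1\<^sub>m m"
      using hcat_mult_adj[OF B(1) C(1) B(1) C(1)] \<open>B * adj B + C * adj C = 1\<^sub>m m\<close> by simp
  qed
  ultimately show ?thesis using that C CC by blast
qed

section \<open>Matrices with orthogonal columns\<close>

text \<open>The value at a dual number of the first order Taylor expansion of the reciprocal.\<close>

definition dual_inverse :: "real dual \<Rightarrow> real dual" where
  "dual_inverse x = Dual (1 / std_part x) (- inf_part x / (std_part x)\<^sup>2)"

lemma dual_inverse_mult: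
  assumes "appreciable x"
  shows "dual_inverse x * x = 1" "x * dual_inverse x = 1"
  using assms by (auto simp: dual_eq_iff dual_inverse_def appreciable_def power2_eq_square field_simps)

text \<open>The value at a dual number of the first order Taylor expansion of the square root.\<close>

definition dual_sqrt :: "real dual \<Rightarrow> real dual" where
  "dual_sqrt x = Dual (sqrt (std_part x)) (inf_part x / (2 * sqrt (std_part x)))"

lemma dual_sqrt_square:
  assumes "0 < std_part x"
  shows "dual_sqrt x * dual_sqrt x = x" "appreciable (dual_sqrt x)"
  using assms by (auto simp: dual_eq_iff dual_sqrt_def appreciable_def field_simps)

lemma gram_diagonal_std:
  fixes M :: "dual_quat mat"
  assumes M: "M \<in> carrier_mat m n" and G: "adj M * M = dq_diag n f" and i: "i < n"
  shows "std_part (f i) = (\<Sum>a<m. qnorm2 (std_part (M $$ (a, i))))"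
proof -
  have "QRe (std_part ((adj M * M) $$ (i, i))) = (\<Sum>a<m. qnorm2 (std_part (M $$ (a, i))))"
    unfolding mult_mat_index[OF adj_carrier[OF M] M i i] using M i
    by (simp add: dual_sum_sel quat_sum_sel star_mult_self del: times_quat.sel)
  then show ?thesis
    unfolding G using i by (simp add: dq_diag_def mat_diag_def dual.map_sel)
qed

lemma gram_diagonal_nonneg:
  fixes M :: "dual_quat mat"
  assumes "M \<in> carrier_mat m n" "adj M * M = dq_diag n f" "i < n"
  shows "0 \<le> std_part (f i)"
  unfolding gram_diagonal_std[OF assms] by (intro sum_nonneg) simp

text \<open>A column whose squared norm is infinitesimal is itself infinitesimal, and the square of an
  infinitesimal is zero.\<close>

lemma gram_diagonal_eq_0:
  fixes M :: "dual_quat mat"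
  assumes M: "M \<in> carrier_mat m n" and G: "adj M * M = dq_diag n f" and i: "i < n"
    and f: "std_part (f i) = 0"
  shows "f i = 0" "\<And>a. a < m \<Longrightarrow> std_part (M $$ (a, i)) = 0"
proof -
  have "(\<Sum>a<m. qnorm2 (std_part (M $$ (a, i)))) = 0"
    using gram_diagonal_std[OF M G i] f by simp
  then show z: "std_part (M $$ (a, i)) = 0" if "a < m" for a
    using that by (simp add: sum_nonneg_eq_0_iff)
  have "inf_part ((adj M * M) $$ (i, i)) = 0"
    unfolding mult_mat_index[OF adj_carrier[OF M] M i i] using M i z
    by (simp add: dual_sum_sel)
  then have "inf_part (f i) = 0"
    unfolding G using i by (simp add: dq_diag_def mat_diag_def dual.map_sel quat_eq_iff)
  then show "f i = 0" using f by (simp add: dual_eq_iff)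
qed

lemma gram_zero_std_mat:
  fixes M :: "dual_quat mat"
  assumes "M \<in> carrier_mat m n" "adj M * M = 0\<^sub>m n n"
  shows "std_mat M = 0\<^sub>m m n"
proof -
  have "adj M * M = dq_diag n (\<lambda>_. 0)" using assms by (simp add: dq_diag_zero)
  from gram_diagonal_eq_0(2)[OF assms(1) this] show ?thesis
    using assms(1) by (intro eq_matI) auto
qed

text \<open>The normalised columns \<open>B = M\<^sub>1 diag(g)\<^sup>-\<^sup>1\<close> are orthonormal; \<open>C\<close> completes them. The columns of \<open>M\<^sub>2\<close>
  have norm zero, which over the dual numbers only says that they are infinitesimal: this is the
  part that \<open>C\<^sup>*M\<^sub>2\<close> retains. Both orders of \<open>B\<close> and \<open>C\<close> are of use, since the diagonal block has to
  end up in the upper left corner in one case and in the lower right corner in the other case.\<close>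

lemma orthogonal_columns_reduction:
  fixes M1 M2 :: "dual_quat mat"
  assumes M: "M1 \<in> carrier_mat m k" "M2 \<in> carrier_mat m j"
    and gram: "adj (hcat M1 M2) * hcat M1 M2 = dq_diag k (\<lambda>i. g i * g i) \<oplus>\<^sub>m 0\<^sub>m j j"
    and g: "\<And>i. i < k \<Longrightarrow> appreciable (g i)"
  obtains B C h where "B \<in> carrier_mat m k" "C \<in> carrier_mat m h" "m = k + h"
    and "unitary_mat m (hcat B C)" "unitary_mat m (hcat C B)"
    and "adj B * M1 = dq_diag k g" "adj B * M2 = 0\<^sub>m k j" "adj C * M1 = 0\<^sub>m h k"
    and "std_mat (adj C * M2) = 0\<^sub>m h j"
proof -
  define D where "D = dq_diag k g"
  define E where "E = dq_diag k (\<lambda>i. dual_inverse (g i))"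
  have D: "D \<in> carrier_mat k k" "adj D = D" and E: "E \<in> carrier_mat k k" "adj E = E"
    by (simp_all add: D_def E_def adj_dq_diag)
  have ED: "E * D = 1\<^sub>m k"
    unfolding E_def D_def dq_diag_mult dq_diag_one[symmetric]
    by (rule dq_diag_cong) (simp add: dual_inverse_mult g)
  have DE: "D * E = 1\<^sub>m k"
    unfolding E_def D_def dq_diag_mult dq_diag_one[symmetric]
    by (rule dq_diag_cong) (simp add: dual_inverse_mult g)
  note Ma = adj_carrier[OF M(1)] adj_carrier[OF M(2)]
  have "four_block_mat (adj M1 * M1) (adj M1 * M2) (adj M2 * M1) (adj M2 * M2)
      = four_block_mat (D * D) (0\<^sub>m k j) (0\<^sub>m j k) (0\<^sub>m j j)"
    using gram adj_hcat_mult[OF M M] D by (simp add: dsum_def D_def dq_diag_mult)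
  then have MM: "adj M1 * M1 = D * D" "adj M1 * M2 = 0\<^sub>m k j" "adj M2 * M2 = 0\<^sub>m j j"
    by (rule four_block_mat_inject[of _ _ _ _ _ _ _ _ k k j j],
        use mult_carrier_mat[OF Ma(1) M(1)] mult_carrier_mat[OF Ma(1) M(2)]
          mult_carrier_mat[OF Ma(2) M(1)] mult_carrier_mat[OF Ma(2) M(2)] D in simp_all)+
  define B where "B = M1 * E"
  have B: "B \<in> carrier_mat m k" unfolding B_def using M(1) E(1) by (rule mult_carrier_mat)
  have adjB: "adj B = E * adj M1"
    unfolding B_def adj_mult[OF M(1) E(1)] E(2) ..
  have M1: "M1 = B * D"
    unfolding B_def using M E D ED by (simp add: assoc_mult_mat[of _ m k _ k _ k])
  have B_M1: "adj B * M1 = D"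
  proof -
    have "adj B * M1 = E * (D * D)"
      unfolding adjB MM(1)[symmetric] using E M Ma by (intro assoc_mult_mat[of _ k k _ m _ k])
    also have "\<dots> = E * D * D"
      using E D by (intro assoc_mult_mat[symmetric, of _ k k _ k _ k])
    finally show ?thesis using ED D by simp
  qed
  have BB: "adj B * B = 1\<^sub>m k"
  proof -
    have "adj B * B = adj B * M1 * E"
      unfolding B_def using assoc_mult_mat[OF adj_carrier[OF B] M(1) E(1)] by (simp add: B_def)
    then show ?thesis using B_M1 DE by simp
  qed
  obtain C h where C: "C \<in> carrier_mat m h" and m: "m = k + h"
    and BC: "adj B * C = 0\<^sub>m k h" "adj C * B = 0\<^sub>m h k" "adj C * C = 1\<^sub>m h"
    and sum: "B * adj B + C * adj C = 1\<^sub>m m"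
    using orthonormal_completion[OF B BB] by blast
  have Ca: "adj C \<in> carrier_mat h m" using C by auto
  show ?thesis
  proof (rule that[OF B C m])
    show "unitary_mat m (hcat B C)"
      by (rule unitary_hcatI[OF B C m BB BC sum])
    have "C * adj C + B * adj B = 1\<^sub>m m"
      unfolding sum[symmetric]
      by (rule comm_add_mat[OF mult_carrier_mat[OF C Ca] mult_carrier_mat[OF B adj_carrier[OF B]]])
    then show "unitary_mat m (hcat C B)"
      using m by (intro unitary_hcatI[OF C B _ BC(3,2,1) BB]) auto
    show "adj B * M1 = dq_diag k g" using B_M1 by (simp add: D_def)
    have "adj B * M2 = E * (adj M1 * M2)"
      unfolding adjB using E M Ma by (intro assoc_mult_mat[of _ k k _ m _ j])
    then show "adj B * M2 = 0\<^sub>m k j" using MM E by simp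
    have "adj C * M1 = adj C * B * D"
      unfolding M1 using Ca B D by (intro assoc_mult_mat[symmetric, of _ h m _ k _ k])
    then show "adj C * M1 = 0\<^sub>m h k" using BC D by simp
    show "std_mat (adj C * M2) = 0\<^sub>m h j"
      unfolding std_mat_mult[OF Ca M(2)] gram_zero_std_mat[OF M(2) MM(3)]
      using Ca by (simp add: right_mult_zero_mat[of _ h m])
  qed
qed

lemma adj_hcat_orthogonal:
  assumes "B \<in> carrier_mat m k" "C \<in> carrier_mat m h" "X \<in> carrier_mat m p" "Y \<in> carrier_mat m q"
    and "adj B * Y = 0\<^sub>m k q" "adj C * X = 0\<^sub>m h p"
  shows "adj (hcat B C) * hcat X Y = (adj B * X) \<oplus>\<^sub>m (adj C * Y)"
  unfolding adj_hcat_mult[OF assms(1-4)] dsum_def assms(5,6) using assms(1-4) by simp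

section \<open>Singular value decomposition of infinitesimal matrices\<close>

text \<open>Write \<open>A = Z\<epsilon>\<close> with a real quaternion matrix \<open>Z\<close>. Diagonalising \<open>Z\<^sup>*Z\<close> makes the columns of \<open>ZV\<close>
  orthogonal, and the reduction of orthogonal columns applies to \<open>ZV\<close> as a dual quaternion matrix. It
  may return a \<open>U\<close> with an infinitesimal part, which multiplication by \<open>\<epsilon>\<close> makes invisible.\<close>

theorem infinitesimal_svd:
  fixes A :: "dual_quat mat"
  assumes A: "A \<in> carrier_mat m k" "std_mat A = 0\<^sub>m m k"
  obtains U V r p p' \<sigma> where "unitary_mat m U" "unitary_mat k V" "m = r + p'" "k = r + p"
    and "adj U * A * V = dq_diag_eps r \<sigma> \<oplus>\<^sub>m 0\<^sub>m p' p"
    and "\<forall>i<r. 0 < \<sigma> i" "\<forall>j<r. \<forall>i\<le>j. \<sigma> j \<le> \<sigma> i"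
proof -
  define Z where "Z = inf_mat A"
  have Z: "Z \<in> carrier_mat m k" using A by (simp add: Z_def)
  have Za: "adj Z \<in> carrier_mat k m" using Z by auto
  have ZZ: "adj Z * Z \<in> carrier_mat k k" using Za Z by (rule mult_carrier_mat)
  have "adj (adj Z * Z) = adj Z * Z"
    using adj_mult[OF Za Z] by simp
  then obtain V0 ev where "V0 \<in> block_unitary k (\<lambda>_. 0)"
    and ev: "adj V0 * (adj Z * Z) * V0 = mat_diag k (\<lambda>i. of_real (ev i))"
    and mono: "\<And>i j. i \<le> j \<Longrightarrow> j < k \<Longrightarrow> ev j \<le> ev i"
    using quat_hermitian_diagonalisation[OF ZZ, of "\<lambda>_. 0"] by auto
  then have V0: "unitary_mat k V0" by (simp add: block_unitary_def)
  note V0c = unitary_matD[OF V0]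
  define Y where "Y = Z * V0"
  have Y: "Y \<in> carrier_mat m k" unfolding Y_def using Z V0c(1) by (rule mult_carrier_mat)
  have "adj Y * Y = adj V0 * (adj Z * Z) * V0"
  proof -
    have "adj Y * Y = adj V0 * adj Z * (Z * V0)"
      unfolding Y_def adj_mult[OF Z V0c(1)] ..
    also have "\<dots> = adj V0 * adj Z * Z * V0"
      using V0c Z mult_carrier_mat[OF V0c(2) Za] by (intro assoc_mult_mat[symmetric, of _ k m _ k _ k]) auto
    also have "adj V0 * adj Z * Z = adj V0 * (adj Z * Z)"
      using V0c Z Za by (intro assoc_mult_mat[of _ k k _ m _ k])
    finally show ?thesis .
  qed
  then have YY: "adj Y * Y = mat_diag k (\<lambda>i. of_real (ev i))" using ev by simp
  define M where "M = dual_mat Y (0\<^sub>m m k)"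
  have M: "M \<in> carrier_mat m k" using Y by (auto simp: M_def)
  have gram: "adj M * M = dq_diag k (\<lambda>i. Dual (ev i) 0)"
  proof -
    have "adj M * M = dual_mat (adj Y * Y) (0\<^sub>m k k)"
      using Y adj_carrier[OF Y] unfolding M_def
      by (simp add: adj_dual_mat[of _ m k] dual_mat_mult[of _ k m _ k] right_mult_zero_mat[of _ k m]
          left_mult_zero_mat[of _ m k])
    also have "\<dots> = dq_diag k (\<lambda>i. Dual (ev i) 0)"
      unfolding YY dq_diag_eq_dual_mat
      by (intro arg_cong2[where f = dual_mat] eq_matI) (auto simp: mat_diag_def)
    finally show ?thesis .
  qed
  have nonneg: "0 \<le> ev i" if "i < k" for i
    using gram_diagonal_nonneg[OF M gram that] by simp
  have "\<exists>r\<le>k. \<forall>i<k. 0 < ev i \<longleftrightarrow> i < r"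
    by (intro downward_closed_initial_segment) (use mono in force)
  then obtain r where r: "r \<le> k" "\<And>i. i < k \<Longrightarrow> 0 < ev i \<longleftrightarrow> i < r" by blast
  define p where "p = k - r"
  have k: "k = r + p" using r by (simp add: p_def)
  define g where "g i = Dual (sqrt (ev i)) 0" for i
  have ev_split: "dq_diag k (\<lambda>i. Dual (ev i) 0) = dq_diag r (\<lambda>i. g i * g i) \<oplus>\<^sub>m 0\<^sub>m p p"
  proof -
    have "dq_diag r (\<lambda>i. Dual (ev i) 0) = dq_diag r (\<lambda>i. g i * g i)"
      by (rule dq_diag_cong) (use nonneg k in \<open>simp add: g_def dual_eq_iff\<close>)
    moreover have "dq_diag p (\<lambda>i. Dual (ev (r + i)) 0) = 0\<^sub>m p p"
      unfolding dq_diag_zero[symmetric]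
    proof (rule dq_diag_cong)
      fix i assume "i < p"
      then show "Dual (ev (r + i)) 0 = 0"
        using nonneg[of "r + i"] r(2)[of "r + i"] k by (simp add: dual_eq_iff)
    qed
    ultimately show ?thesis unfolding k dq_diag_add by simp
  qed
  obtain M1 M2 where M12: "M1 \<in> carrier_mat m r" "M2 \<in> carrier_mat m p" "M = hcat M1 M2"
    using hcat_split[of M m r p] M k by auto
  have gram': "adj (hcat M1 M2) * hcat M1 M2 = dq_diag r (\<lambda>i. g i * g i) \<oplus>\<^sub>m 0\<^sub>m p p"
    using gram ev_split M12(3) by simp
  have g: "appreciable (g i)" if "i < r" for i
    using r(2)[of i] that k by (simp add: g_def appreciable_def)
  obtain B C p' where BC: "B \<in> carrier_mat m r" "C \<in> carrier_mat m p'" "m = r + p'"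
    and U: "unitary_mat m (hcat B C)" "unitary_mat m (hcat C B)"
    and red: "adj B * M1 = dq_diag r g" "adj B * M2 = 0\<^sub>m r p" "adj C * M1 = 0\<^sub>m p' r"
      "std_mat (adj C * M2) = 0\<^sub>m p' p"
    by (rule orthogonal_columns_reduction[OF M12(1,2) gram' g])
  define U where "U = hcat B C"
  have Uu: "unitary_mat m U" using U by (simp add: U_def)
  note Uc = unitary_matD[OF Uu]
  have UM: "adj U * M = dq_diag r g \<oplus>\<^sub>m (adj C * M2)"
    unfolding U_def M12(3) using adj_hcat_orthogonal[OF BC(1,2) M12(1,2) red(2,3)] red(1) by simp
  define V where "V = dual_mat V0 (0\<^sub>m k k)"
  have V: "unitary_mat k V" unfolding V_def by (rule unitary_dual_mat[OF V0])
  define S :: "quat mat" where "S = mat_diag r (\<lambda>i. of_real (sqrt (ev i))) \<oplus>\<^sub>m 0\<^sub>m p' p"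
  have CM2: "adj C * M2 \<in> carrier_mat p' p"
    using adj_carrier[OF BC(2)] M12(2) by (rule mult_carrier_mat)
  have AV: "A * V = dual_mat (0\<^sub>m m k) Y"
  proof -
    have "A = dual_mat (0\<^sub>m m k) Z"
      using dual_mat_std_inf[of A] A by (simp add: Z_def)
    then show ?thesis
      unfolding V_def using Z V0c Y by (simp add: dual_mat_mult[of _ m k _ k] Y_def[symmetric])
  qed
  have "adj U * (A * V) = dq_diag_eps r (\<lambda>i. sqrt (ev i)) \<oplus>\<^sub>m 0\<^sub>m p' p" (is "?L = ?R")
  proof (rule dual_mat_eqI[of _ m k])
    have c: "A * V \<in> carrier_mat m k" using A(1) unitary_matD(1)[OF V] by (rule mult_carrier_mat)
    show "?L \<in> carrier_mat m k" using Uc(2) c by (rule mult_carrier_mat)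
    show "?R \<in> carrier_mat m k" using k BC(3) by (auto simp: dq_diag_eps_def)
    have sU: "std_mat (adj U) \<in> carrier_mat m m" "inf_mat (adj U) \<in> carrier_mat m m" using Uc by auto
    have "std_mat ?L = std_mat (adj U) * 0\<^sub>m m k"
      unfolding std_mat_mult[OF Uc(2) c] unfolding AV by simp
    also have "\<dots> = 0\<^sub>m m k" by (rule right_mult_zero_mat[OF sU(1)])
    also have "\<dots> = std_mat ?R"
      by (rule eq_matI)
         (auto simp: k BC(3) dq_diag_eps_def dq_diag_def mat_diag_def dsum_def dual.map_sel)
    finally show "std_mat ?L = std_mat ?R" .
    have "inf_mat ?L = std_mat (adj U) * Y + inf_mat (adj U) * 0\<^sub>m m k"
      unfolding inf_mat_mult[OF Uc(2) c] unfolding AV using Y by (simp add: inf_mat_dual_mat[of _ m k])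
    also have "\<dots> = std_mat (adj U) * Y"
      using right_mult_zero_mat[OF sU(2)] right_add_zero_mat[OF mult_carrier_mat[OF sU(1) Y]] by simp
    also have "\<dots> = std_mat (adj U * M)"
      unfolding std_mat_mult[OF Uc(2) M] by (simp add: M_def)
    also have "\<dots> = std_mat (dq_diag r g) \<oplus>\<^sub>m std_mat (adj C * M2)"
      unfolding UM by (rule eq_matI) (use CM2 in \<open>auto simp: dsum_def\<close>)
    also have "\<dots> = inf_mat ?R"
      unfolding red(4)
      by (rule eq_matI)
         (auto simp: dq_diag_eps_def dq_diag_def mat_diag_def dsum_def dual.map_sel g_def)
    finally show "inf_mat ?L = inf_mat ?R" .
  qed
  moreover have "adj U * (A * V) = adj U * A * V"
    using Uc A unitary_matD[OF V] by (simp add: assoc_mult_mat[of _ m m _ k _ k])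
  ultimately show ?thesis
  proof (intro that[OF Uu V BC(3) k, of "\<lambda>i. sqrt (ev i)"])
    show "\<forall>i<r. 0 < sqrt (ev i)" using r(2) k by simp
    show "\<forall>j<r. \<forall>i\<le>j. sqrt (ev j) \<le> sqrt (ev i)" using mono k by simp
  qed simp
qed

section \<open>The first block column\<close>

lemma dual_sqrt_one: "dual_sqrt 1 = 1"
  by (simp add: dual_sqrt_def dual_eq_iff)

lemma dual_sqrt_mono:
  assumes "x \<le> y" "0 < std_part x"
  shows "dual_sqrt x \<le> dual_sqrt y"
  using assms
  by (auto simp: less_eq_dual_def less_dual_def dual_sqrt_def dual_eq_iff divide_less_cancel)

lemma dual_sqrt_bounds:
  assumes "0 < std_part x" "std_part x < 1"
  shows "0 < dual_sqrt x" "dual_sqrt x < 1"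
  using assms by (auto simp: less_dual_def dual_sqrt_def)

lemma gram_hcat_swap:
  assumes "X \<in> carrier_mat m k" "Y \<in> carrier_mat m j"
    and "adj (hcat X Y) * hcat X Y = E \<oplus>\<^sub>m F" "E \<in> carrier_mat k k" "F \<in> carrier_mat j j"
  shows "adj (hcat Y X) * hcat Y X = F \<oplus>\<^sub>m E"
proof -
  note c = adj_carrier[OF assms(1)] adj_carrier[OF assms(2)]
  note cc = mult_carrier_mat[OF c(1) assms(1)] mult_carrier_mat[OF c(1) assms(2)]
    mult_carrier_mat[OF c(2) assms(1)] mult_carrier_mat[OF c(2) assms(2)]
  have "four_block_mat (adj X * X) (adj X * Y) (adj Y * X) (adj Y * Y)
      = four_block_mat E (0\<^sub>m k j) (0\<^sub>m j k) F"
    using assms adj_hcat_mult[OF assms(1,2,1,2)] by (simp add: dsum_def)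
  then have "adj X * X = E" "adj X * Y = 0\<^sub>m k j" "adj Y * X = 0\<^sub>m j k" "adj Y * Y = F"
    by (rule four_block_mat_inject[of _ _ _ _ _ _ _ _ k k j j], use cc assms(4,5) in simp_all)+
  then show ?thesis
    using adj_hcat_mult[OF assms(2,1,2,1)] assms(4,5) by (simp add: dsum_def)
qed

lemma adj_mult_sandwich_right:
  assumes "U \<in> carrier_mat m n" "U' \<in> carrier_mat n k" "A \<in> carrier_mat m p" "V \<in> carrier_mat p q"
  shows "adj (U * U') * A * V = adj U' * (adj U * A) * V"
  using adj_mult_sandwich[OF assms(1-3) one_carrier_mat assms(4)] assms
    mult_carrier_mat[OF adj_carrier[OF assms(1)] assms(3)]
  by simp

lemma dq_diag_minus:
  "dq_diag n (\<lambda>i. 1 - f i) = 1\<^sub>m n - dq_diag n f"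
  by (rule eq_matI) (auto simp: dq_diag_def mat_diag_def dual_eq_iff dual.map_sel)

text \<open>The sequence \<open>f\<close> falls into \<open>a\<close> entries \<open>1\<close>, then \<open>l\<close> entries whose standard part lies strictly between
  \<open>0\<close> and \<open>1\<close>, then \<open>b'\<close> entries \<open>0\<close>. The appreciable columns are the first \<open>a + l\<close> ones of \<open>M\<close> and the last
  \<open>l + b'\<close> ones of \<open>N\<close>. Their reduction leaves infinitesimal corners \<open>Y\<close> (lower right, in \<open>M\<close>) and \<open>Z\<close>
  (upper left, in \<open>N\<close>). The singular vectors \<open>V\<^sub>z\<close> and \<open>V\<^sub>y\<close> rotate columns on which \<open>M\<close>, respectively \<open>N\<close>,
  is an identity; using them on the rows of that block as well preserves this identity.\<close>

theorem block_column_decomposition: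
  fixes M N :: "dual_quat mat"
  assumes M: "M \<in> carrier_mat r1 t1" and N: "N \<in> carrier_mat r2 t1"
    and gram_M: "adj M * M = dq_diag t1 f" and gram_N: "adj N * N = dq_diag t1 (\<lambda>i. 1 - f i)"
    and mono: "\<And>i j. i \<le> j \<Longrightarrow> j < t1 \<Longrightarrow> f j \<le> f i"
  obtains U1 U2 V r p p' l t q q' \<sigma> d c s where
    "unitary_mat r1 U1" "unitary_mat r2 U2" "unitary_mat t1 V"
    "r1 = r + (p + (l + (t + q)))" "r2 = r + (p' + (l + (t + q')))" "t1 = r + (p + (l + (t + q')))"
    "adj U1 * M * V = 1\<^sub>m r \<oplus>\<^sub>m 1\<^sub>m p \<oplus>\<^sub>m dq_diag l c \<oplus>\<^sub>m dq_diag_eps t d \<oplus>\<^sub>m 0\<^sub>m q q'"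
    "adj U2 * N * V = dq_diag_eps r \<sigma> \<oplus>\<^sub>m 0\<^sub>m p' p \<oplus>\<^sub>m dq_diag l s \<oplus>\<^sub>m 1\<^sub>m t \<oplus>\<^sub>m 1\<^sub>m q'"
    "\<forall>i<r. 0 < \<sigma> i" "\<forall>j<r. \<forall>i\<le>j. \<sigma> j \<le> \<sigma> i"
    "\<forall>i<t. 0 < d i" "\<forall>j<t. \<forall>i\<le>j. d j \<le> d i"
    "\<forall>i<l. appreciable (c i) \<and> 0 < c i \<and> c i < 1" "\<forall>j<l. \<forall>i\<le>j. c j \<le> c i"
    "\<forall>i<l. appreciable (s i) \<and> 0 < s i \<and> s i < 1" "\<forall>j<l. \<forall>i\<le>j. s i \<le> s j"
    "dq_diag l c * dq_diag l c + dq_diag l s * dq_diag l s = 1\<^sub>m l"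
proof -
  have f0: "0 \<le> std_part (f i)" "std_part (f i) = 0 \<Longrightarrow> f i = 0" if "i < t1" for i
    using gram_diagonal_nonneg[OF M gram_M that] gram_diagonal_eq_0(1)[OF M gram_M that] by auto
  have f1: "std_part (f i) \<le> 1" "std_part (f i) = 1 \<Longrightarrow> f i = 1" if "i < t1" for i
    using gram_diagonal_nonneg[OF N gram_N that] gram_diagonal_eq_0(1)[OF N gram_N that]
    by (auto simp: dual_eq_iff)
  have std_mono: "std_part (f j) \<le> std_part (f i)" if "i \<le> j" "j < t1" for i j
    using mono[OF that] by (auto simp: less_eq_dual_def less_dual_def)
  have "std_part (f i) = 1" if "i \<le> j" "j < t1" "std_part (f j) = 1" for i j
    using std_mono[of i j] f1(1)[of i] that by simp
  then have "\<exists>a\<le>t1. \<forall>i<t1. std_part (f i) = 1 \<longleftrightarrow> i < a"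
    by (intro downward_closed_initial_segment) blast
  then obtain a where a: "a \<le> t1" "\<And>i. i < t1 \<Longrightarrow> std_part (f i) = 1 \<longleftrightarrow> i < a" by blast
  have "0 < std_part (f i)" if "i \<le> j" "j < t1" "0 < std_part (f j)" for i j
    using std_mono[of i j] that by simp
  then have "\<exists>e\<le>t1. \<forall>i<t1. 0 < std_part (f i) \<longleftrightarrow> i < e"
    by (intro downward_closed_initial_segment) blast
  then obtain e where e: "e \<le> t1" "\<And>i. i < t1 \<Longrightarrow> 0 < std_part (f i) \<longleftrightarrow> i < e" by blast
  have "a \<le> e"
  proof (rule ccontr)
    assume "\<not> a \<le> e"
    then have "e < t1" "e < a" using a(1) by auto
    then show False using a(2)[of e] e(2)[of e] by simp
  qed
  define l b' where "l = e - a" and "b' = t1 - e"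
  have t1: "t1 = a + (l + b')" using \<open>a \<le> e\<close> e(1) by (simp add: l_def b'_def)
  have e_eq: "e = a + l" using \<open>a \<le> e\<close> by (simp add: l_def)
  have fa: "f i = 1" if "i < a" for i using that a f1(2)[of i] t1 by simp
  have fb: "f (a + (l + i)) = 0" if "i < b'" for i
    using that e(2)[of "a + (l + i)"] f0[of "a + (l + i)"] t1 e_eq by auto
  have fl: "0 < std_part (f (a + i))" "std_part (f (a + i)) < 1" if "i < l" for i
    using that e(2)[of "a + i"] a(2)[of "a + i"] f1(1)[of "a + i"] t1 e_eq by auto
  define c where "c i = dual_sqrt (f (a + i))" for i
  define s where "s i = dual_sqrt (1 - f (a + i))" for i

  \<comment> \<open>the columns of \<open>M\<close> of appreciable norm come first\<close>
  have "M \<in> carrier_mat r1 ((a + l) + b')" using M t1 by (simp add: add.assoc)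
  then obtain M1 M2 where M12: "M1 \<in> carrier_mat r1 (a + l)" "M2 \<in> carrier_mat r1 b'" "M = hcat M1 M2"
    by (rule hcat_split)
  define g where "g i = dual_sqrt (f i)" for i
  have g: "g i * g i = f i" "appreciable (g i)" if "i < a + l" for i
    using dual_sqrt_square[of "f i"] e(2)[of i] that t1 e_eq by (auto simp: g_def)
  have g_diag: "dq_diag (a + l) g = 1\<^sub>m a \<oplus>\<^sub>m dq_diag l c"
  proof -
    have "dq_diag a g = 1\<^sub>m a"
      unfolding dq_diag_one[symmetric] by (rule dq_diag_cong) (simp add: g_def fa dual_sqrt_one)
    moreover have "(\<lambda>i. g (a + i)) = c" by (simp add: fun_eq_iff g_def c_def)
    ultimately show ?thesis by (simp add: dq_diag_add)
  qed
  have "adj (hcat M1 M2) * hcat M1 M2 = dq_diag (a + l) f \<oplus>\<^sub>m dq_diag b' (\<lambda>i. f (a + l + i))"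
    using gram_M M12(3) dq_diag_add[of "a + l" b' f] by (simp add: t1 add.assoc)
  also have "dq_diag (a + l) f = dq_diag (a + l) (\<lambda>i. g i * g i)"
    by (rule dq_diag_cong) (simp add: g)
  also have "dq_diag b' (\<lambda>i. f (a + l + i)) = 0\<^sub>m b' b'"
    unfolding dq_diag_zero[symmetric] by (rule dq_diag_cong) (simp add: fb add.assoc)
  finally have gram1: "adj (hcat M1 M2) * hcat M1 M2 = dq_diag (a + l) (\<lambda>i. g i * g i) \<oplus>\<^sub>m 0\<^sub>m b' b'" .
  obtain B C b where BC: "B \<in> carrier_mat r1 (a + l)" "C \<in> carrier_mat r1 b" and r1: "r1 = a + l + b"
    and X1: "unitary_mat r1 (hcat B C)" "unitary_mat r1 (hcat C B)"
    and red1: "adj B * M1 = dq_diag (a + l) g" "adj B * M2 = 0\<^sub>m (a + l) b'" "adj C * M1 = 0\<^sub>m b (a + l)"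
      "std_mat (adj C * M2) = 0\<^sub>m b b'"
    by (rule orthogonal_columns_reduction[OF M12(1,2) gram1 g(2)])
  define Y where "Y = adj C * M2"
  have Y: "Y \<in> carrier_mat b b'" "std_mat Y = 0\<^sub>m b b'"
    using mult_carrier_mat[OF adj_carrier[OF BC(2)] M12(2)] red1(4) by (simp_all add: Y_def)
  have X1_M: "adj (hcat B C) * M = 1\<^sub>m a \<oplus>\<^sub>m dq_diag l c \<oplus>\<^sub>m Y"
    unfolding M12(3) adj_hcat_orthogonal[OF BC(1,2) M12(1,2) red1(2,3)] red1(1) g_diag
    by (simp add: dsum_assoc Y_def)

  \<comment> \<open>the columns of \<open>N\<close> of appreciable norm come last\<close>
  obtain N2 N1 where N12: "N2 \<in> carrier_mat r2 a" "N1 \<in> carrier_mat r2 (l + b')" "N = hcat N2 N1"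
    using hcat_split[of N r2 a "l + b'"] N t1 by auto
  have g': "s i * s i = 1 - f (a + i)" "appreciable (s i)" if "i < l + b'" for i
  proof -
    have "std_part (f (a + i)) < 1"
      using a(2)[of "a + i"] f1(1)[of "a + i"] that t1 by auto
    then show "s i * s i = 1 - f (a + i)" "appreciable (s i)"
      using dual_sqrt_square[of "1 - f (a + i)"] by (auto simp: s_def)
  qed
  have s_diag: "dq_diag (l + b') s = dq_diag l s \<oplus>\<^sub>m 1\<^sub>m b'"
  proof -
    have "dq_diag b' (\<lambda>i. s (l + i)) = 1\<^sub>m b'"
      unfolding dq_diag_one[symmetric] by (rule dq_diag_cong) (simp add: s_def fb dual_sqrt_one)
    then show ?thesis by (simp add: dq_diag_add)
  qed
  have "adj (hcat N2 N1) * hcat N2 N1 = dq_diag a (\<lambda>i. 1 - f i) \<oplus>\<^sub>m dq_diag (l + b') (\<lambda>i. 1 - f (a + i))"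
    using gram_N N12(3) by (simp add: t1 dq_diag_add[of a "l + b'"])
  also have "dq_diag (l + b') (\<lambda>i. 1 - f (a + i)) = dq_diag (l + b') (\<lambda>i. s i * s i)"
    by (rule dq_diag_cong) (simp add: g')
  also have "dq_diag a (\<lambda>i. 1 - f i) = 0\<^sub>m a a"
    unfolding dq_diag_zero[symmetric] by (rule dq_diag_cong) (simp add: fa)
  finally have "adj (hcat N1 N2) * hcat N1 N2 = dq_diag (l + b') (\<lambda>i. s i * s i) \<oplus>\<^sub>m 0\<^sub>m a a"
    by (rule gram_hcat_swap[OF N12(1,2)]) auto
  then obtain B' C' a' where BC': "B' \<in> carrier_mat r2 (l + b')" "C' \<in> carrier_mat r2 a'" and r2: "r2 = l + b' + a'"
    and X2: "unitary_mat r2 (hcat B' C')" "unitary_mat r2 (hcat C' B')"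
    and red2: "adj B' * N1 = dq_diag (l + b') s" "adj B' * N2 = 0\<^sub>m (l + b') a"
      "adj C' * N1 = 0\<^sub>m a' (l + b')" "std_mat (adj C' * N2) = 0\<^sub>m a' a"
    by (rule orthogonal_columns_reduction[OF N12(2,1) _ g'(2)])
  define Z where "Z = adj C' * N2"
  have Z: "Z \<in> carrier_mat a' a" "std_mat Z = 0\<^sub>m a' a"
    using mult_carrier_mat[OF adj_carrier[OF BC'(2)] N12(1)] red2(4) by (simp_all add: Z_def)
  have X2_N: "adj (hcat C' B') * N = Z \<oplus>\<^sub>m dq_diag l s \<oplus>\<^sub>m 1\<^sub>m b'"
    unfolding N12(3) adj_hcat_orthogonal[OF BC'(2,1) N12(1,2) red2(3,2)] red2(1) s_diag
    by (simp add: Z_def)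

  \<comment> \<open>only the infinitesimal corners \<open>Y\<close> and \<open>Z\<close> remain\<close>
  obtain Uz Vz r p p' \<sigma> where Uz: "unitary_mat a' Uz" and Vz: "unitary_mat a Vz"
    and a': "a' = r + p'" and a_eq: "a = r + p"
    and Z_diag: "adj Uz * Z * Vz = dq_diag_eps r \<sigma> \<oplus>\<^sub>m 0\<^sub>m p' p"
    and \<sigma>: "\<forall>i<r. 0 < \<sigma> i" "\<forall>j<r. \<forall>i\<le>j. \<sigma> j \<le> \<sigma> i"
    by (rule infinitesimal_svd[OF Z])
  obtain Uy Vy t q' q d where Uy: "unitary_mat b Uy" and Vy: "unitary_mat b' Vy"
    and b: "b = t + q" and b': "b' = t + q'"
    and Y_diag: "adj Uy * Y * Vy = dq_diag_eps t d \<oplus>\<^sub>m 0\<^sub>m q q'"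
    and d: "\<forall>i<t. 0 < d i" "\<forall>j<t. \<forall>i\<le>j. d j \<le> d i"
    by (rule infinitesimal_svd[OF Y])
  note Uzc = unitary_matD[OF Uz] and Vzc = unitary_matD[OF Vz] and Uyc = unitary_matD[OF Uy]
    and Vyc = unitary_matD[OF Vy]
  define R1 where "R1 = Vz \<oplus>\<^sub>m 1\<^sub>m l \<oplus>\<^sub>m Uy"
  define R2 where "R2 = Uz \<oplus>\<^sub>m 1\<^sub>m l \<oplus>\<^sub>m Vy"
  define V where "V = Vz \<oplus>\<^sub>m 1\<^sub>m l \<oplus>\<^sub>m Vy"
  have R1: "unitary_mat r1 R1" and R2: "unitary_mat r2 R2" and V: "unitary_mat t1 V"
    using unitary_mat_dsum[OF Vz unitary_mat_dsum[OF unitary_mat_one[of l] Uy]]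
      unitary_mat_dsum[OF Uz unitary_mat_dsum[OF unitary_mat_one[of l] Vy]]
      unitary_mat_dsum[OF Vz unitary_mat_dsum[OF unitary_mat_one[of l] Vy]]
    by (simp_all add: R1_def R2_def V_def r1 r2 t1 ac_simps)
  note dims = carrier_matD[OF Uzc(1)] carrier_matD[OF Vzc(1)] carrier_matD[OF Uyc(1)]
    carrier_matD[OF Vyc(1)] carrier_matD[OF Y(1)] carrier_matD[OF Z(1)]
  show ?thesis
  proof (rule that)
    show "unitary_mat r1 (hcat B C * R1)" by (rule unitary_mat_mult[OF X1(1) R1])
    show "unitary_mat r2 (hcat C' B' * R2)" by (rule unitary_mat_mult[OF X2(2) R2])
    show "unitary_mat t1 V" by (rule V)
    show "r1 = r + (p + (l + (t + q)))" "r2 = r + (p' + (l + (t + q')))" "t1 = r + (p + (l + (t + q')))"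
      using r1 r2 t1 a_eq a' b b' by simp_all
    have "adj (hcat B C * R1) * M * V = adj R1 * (1\<^sub>m a \<oplus>\<^sub>m dq_diag l c \<oplus>\<^sub>m Y) * V"
      unfolding adj_mult_sandwich_right[OF unitary_matD(1)[OF X1(1)] unitary_matD(1)[OF R1] M unitary_matD(1)[OF V]]
        X1_M ..
    also have "\<dots> = (adj Vz * 1\<^sub>m a * Vz) \<oplus>\<^sub>m (1\<^sub>m l * dq_diag l c * 1\<^sub>m l) \<oplus>\<^sub>m (adj Uy * Y * Vy)"
      unfolding R1_def V_def by (simp add: adj_dsum dsum_mult dims)
    also have "adj Vz * 1\<^sub>m a * Vz = 1\<^sub>m r \<oplus>\<^sub>m 1\<^sub>m p"
      using Vzc by (simp add: right_mult_one_mat[OF Vzc(2)] dsum_one a_eq)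
    also have "1\<^sub>m l * dq_diag l c * 1\<^sub>m l = dq_diag l c"
      by (simp add: left_mult_one_mat[OF dq_diag_carrier] right_mult_one_mat[OF dq_diag_carrier])
    finally show "adj (hcat B C * R1) * M * V
        = 1\<^sub>m r \<oplus>\<^sub>m 1\<^sub>m p \<oplus>\<^sub>m dq_diag l c \<oplus>\<^sub>m dq_diag_eps t d \<oplus>\<^sub>m 0\<^sub>m q q'"
      by (simp add: Y_diag dsum_assoc)
    have "adj (hcat C' B' * R2) * N * V = adj R2 * (Z \<oplus>\<^sub>m dq_diag l s \<oplus>\<^sub>m 1\<^sub>m b') * V"
      unfolding adj_mult_sandwich_right[OF unitary_matD(1)[OF X2(2)] unitary_matD(1)[OF R2] N unitary_matD(1)[OF V]]
        X2_N ..
    also have "\<dots> = (adj Uz * Z * Vz) \<oplus>\<^sub>m (1\<^sub>m l * dq_diag l s * 1\<^sub>m l) \<oplus>\<^sub>m (adj Vy * 1\<^sub>m b' * Vy)"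
      unfolding R2_def V_def by (simp add: adj_dsum dsum_mult dims)
    also have "adj Vy * 1\<^sub>m b' * Vy = 1\<^sub>m t \<oplus>\<^sub>m 1\<^sub>m q'"
      using Vyc by (simp add: right_mult_one_mat[OF Vyc(2)] dsum_one b')
    also have "1\<^sub>m l * dq_diag l s * 1\<^sub>m l = dq_diag l s"
      by (simp add: left_mult_one_mat[OF dq_diag_carrier] right_mult_one_mat[OF dq_diag_carrier])
    finally show "adj (hcat C' B' * R2) * N * V
        = dq_diag_eps r \<sigma> \<oplus>\<^sub>m 0\<^sub>m p' p \<oplus>\<^sub>m dq_diag l s \<oplus>\<^sub>m 1\<^sub>m t \<oplus>\<^sub>m 1\<^sub>m q'"
      by (simp add: Z_diag dsum_assoc)
    show "\<forall>i<r. 0 < \<sigma> i" "\<forall>j<r. \<forall>i\<le>j. \<sigma> j \<le> \<sigma> i" using \<sigma> by auto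
    show "\<forall>i<t. 0 < d i" "\<forall>j<t. \<forall>i\<le>j. d j \<le> d i" using d by auto
    have fl': "0 < std_part (1 - f (a + i))" "std_part (1 - f (a + i)) < 1" if "i < l" for i
      using fl[OF that] by simp_all
    show "\<forall>i<l. appreciable (c i) \<and> 0 < c i \<and> c i < 1"
      using fl by (simp add: c_def dual_sqrt_square dual_sqrt_bounds)
    show "\<forall>i<l. appreciable (s i) \<and> 0 < s i \<and> s i < 1"
      using fl' unfolding s_def by (blast intro: dual_sqrt_square dual_sqrt_bounds)
    show "\<forall>j<l. \<forall>i\<le>j. c j \<le> c i"
      using fl mono t1 by (auto simp: c_def intro!: dual_sqrt_mono)
    show "\<forall>j<l. \<forall>i\<le>j. s i \<le> s j"
    proof (intro allI impI)
      fix i j assume ij: "j < l" "i \<le> j"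
      have "f (a + j) \<le> f (a + i)" using mono[of "a + i" "a + j"] ij t1 by simp
      then have "1 - f (a + i) \<le> 1 - f (a + j)"
        by (auto simp: less_eq_dual_def less_dual_def)
      then show "s i \<le> s j"
        using fl'(1)[of i] ij unfolding s_def by (intro dual_sqrt_mono) auto
    qed
    have "dq_diag l c * dq_diag l c + dq_diag l s * dq_diag l s
        = dq_diag l (\<lambda>i. f (a + i)) + dq_diag l (\<lambda>i. 1 - f (a + i))"
      unfolding dq_diag_mult c_def s_def
      by (intro arg_cong2[where f = "(+)"] dq_diag_cong dual_sqrt_square(1) fl fl')
    also have "\<dots> = 1\<^sub>m l"
      by (rule eq_matI) (auto simp: dq_diag_def mat_diag_def dual_eq_iff dual.map_sel)
    finally show "dq_diag l c * dq_diag l c + dq_diag l s * dq_diag l s = 1\<^sub>m l" .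
  qed
qed

section \<open>The second block column\<close>

text \<open>The orthonormal completion of a square matrix adds no columns.\<close>

lemma square_isometry_unitary:
  fixes B :: "dual_quat mat"
  assumes B: "B \<in> carrier_mat m m" "adj B * B = 1\<^sub>m m"
  shows "unitary_mat m B"
proof -
  obtain C j where C: "C \<in> carrier_mat m j" "m = m + j" "B * adj B + C * adj C = 1\<^sub>m m"
    using orthonormal_completion[OF B] by metis
  then have "C * adj C = 0\<^sub>m m m"
    by (intro eq_matI) (auto simp: scalar_prod_def)
  then have "B * adj B = 1\<^sub>m m"
    using C(3) right_add_zero_mat[OF mult_carrier_mat[OF B(1) adj_carrier[OF B(1)]]] by simp
  then show ?thesis using B by (simp add: unitary_mat_def)
qed

lemma unitary_mat_dsumD:
  assumes "unitary_mat (m + n) (X \<oplus>\<^sub>m Z)" "X \<in> carrier_mat m m" "Z \<in> carrier_mat n n"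
  shows "unitary_mat n Z"
proof -
  have c: "adj X \<in> carrier_mat m m" "adj Z \<in> carrier_mat n n" using assms by auto
  note cc = mult_carrier_mat[OF c(1) assms(2)] mult_carrier_mat[OF c(2) assms(3)]
    mult_carrier_mat[OF assms(2) c(1)] mult_carrier_mat[OF assms(3) c(2)]
  have "(adj X * X) \<oplus>\<^sub>m (adj Z * Z) = 1\<^sub>m m \<oplus>\<^sub>m 1\<^sub>m n"
    using assms by (simp add: unitary_mat_def adj_dsum dsum_mult dsum_one)
  then have "adj Z * Z = 1\<^sub>m n"
    unfolding dsum_def by (rule four_block_mat_inject(4)[of _ _ _ _ _ _ _ _ m m n n]) (use cc assms in simp_all)
  moreover have "(X * adj X) \<oplus>\<^sub>m (Z * adj Z) = 1\<^sub>m m \<oplus>\<^sub>m 1\<^sub>m n"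
    using assms by (simp add: unitary_mat_def adj_dsum dsum_mult dsum_one)
  then have "Z * adj Z = 1\<^sub>m n"
    unfolding dsum_def by (rule four_block_mat_inject(4)[of _ _ _ _ _ _ _ _ m m n n]) (use cc assms in simp_all)
  ultimately show ?thesis using assms by (simp add: unitary_mat_def)
qed

lemma adj_four_block_mult:
  fixes A1 :: "'a::star_ring mat"
  assumes c1: "A1 \<in> carrier_mat r1 t1" "B1 \<in> carrier_mat r1 t2" "C1 \<in> carrier_mat r2 t1" "D1 \<in> carrier_mat r2 t2"
    and c2: "A2 \<in> carrier_mat r1 u1" "B2 \<in> carrier_mat r1 u2" "C2 \<in> carrier_mat r2 u1" "D2 \<in> carrier_mat r2 u2"
  shows "adj (four_block_mat A1 B1 C1 D1) * four_block_mat A2 B2 C2 D2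
    = four_block_mat (adj A1 * A2 + adj C1 * C2) (adj A1 * B2 + adj C1 * D2)
        (adj B1 * A2 + adj D1 * C2) (adj B1 * B2 + adj D1 * D2)"
  unfolding adj_four_block_mat[OF c1]
  by (rule mult_four_block_mat[OF adj_carrier[OF c1(1)] adj_carrier[OF c1(3)]
        adj_carrier[OF c1(2)] adj_carrier[OF c1(4)] c2])

lemma add_mult_carrier:
  assumes "A \<in> carrier_mat m n" "B \<in> carrier_mat n k" "C \<in> carrier_mat m p" "D \<in> carrier_mat p k"
  shows "A * B + C * D \<in> carrier_mat m k"
  using mult_carrier_mat[OF assms(1,2)] mult_carrier_mat[OF assms(3,4)] by simp

text \<open>Let \<open>W'\<close> be the transformed matrix before anything is done to its second block column. Then \<open>W'\<close> and
  \<open>D\<close> are unitary with the same first block column, so \<open>D\<^sup>*W' = diag(I, Z)\<close> with \<open>Z\<close> unitary, and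
  \<open>W' diag(I, Z\<^sup>*) = D\<close>.\<close>

theorem unitary_complete_block_column:
  fixes W11 :: "dual_quat mat"
  assumes W: "W11 \<in> carrier_mat r1 t1" "W12 \<in> carrier_mat r1 t2" "W21 \<in> carrier_mat r2 t1" "W22 \<in> carrier_mat r2 t2"
    and D: "D11 \<in> carrier_mat r1 t1" "D12 \<in> carrier_mat r1 t2" "D21 \<in> carrier_mat r2 t1" "D22 \<in> carrier_mat r2 t2"
    and uW: "unitary_mat n (four_block_mat W11 W12 W21 W22)"
    and uD: "unitary_mat n (four_block_mat D11 D12 D21 D22)"
    and n: "n = t1 + t2"
    and U1: "unitary_mat r1 U1" and U2: "unitary_mat r2 U2" and V1: "unitary_mat t1 V1"
    and eq1: "adj U1 * W11 * V1 = D11" and eq2: "adj U2 * W21 * V1 = D21"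
  obtains V2 where "unitary_mat t2 V2"
    "(adj U1 \<oplus>\<^sub>m adj U2) * four_block_mat W11 W12 W21 W22 * (V1 \<oplus>\<^sub>m V2) = four_block_mat D11 D12 D21 D22"
proof -
  let ?W = "four_block_mat W11 W12 W21 W22" and ?D = "four_block_mat D11 D12 D21 D22"
  have n': "n = r1 + r2" using unitary_matD(1)[OF uW] W by auto
  note c = unitary_matD[OF U1] unitary_matD[OF U2] unitary_matD[OF V1]
  define W' where "W' = (adj U1 \<oplus>\<^sub>m adj U2) * ?W * (V1 \<oplus>\<^sub>m 1\<^sub>m t2)"
  have uW': "unitary_mat n W'"
    unfolding W'_def
    by (intro unitary_mat_mult uW)
       (use unitary_mat_dsum[OF unitary_mat_adj[OF U1] unitary_mat_adj[OF U2]]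
         unitary_mat_dsum[OF V1 unitary_mat_one] n n' in simp_all)
  define X where "X = adj U1 * W12"
  define Y where "Y = adj U2 * W22"
  have X: "X \<in> carrier_mat r1 t2" and Y: "Y \<in> carrier_mat r2 t2"
    unfolding X_def Y_def by (rule mult_carrier_mat[OF c(2) W(2)], rule mult_carrier_mat[OF c(6) W(4)])
  have W'_eq: "W' = four_block_mat D11 X D21 Y"
  proof -
    have cc: "adj U1 * W11 \<in> carrier_mat r1 t1" "adj U2 * W21 \<in> carrier_mat r2 t1"
      by (rule mult_carrier_mat[OF c(2) W(1)], rule mult_carrier_mat[OF c(6) W(3)])
    have "(adj U1 \<oplus>\<^sub>m adj U2) * ?W = four_block_mat
        (adj U1 * W11 + 0\<^sub>m r1 r2 * W21) (adj U1 * W12 + 0\<^sub>m r1 r2 * W22)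
        (0\<^sub>m r2 r1 * W11 + adj U2 * W21) (0\<^sub>m r2 r1 * W12 + adj U2 * W22)"
      unfolding dsum_def carrier_matD[OF c(2)] carrier_matD[OF c(6)]
      by (rule mult_four_block_mat[OF c(2) _ _ c(6) W]) auto
    also have "\<dots> = four_block_mat (adj U1 * W11) X (adj U2 * W21) Y"
      using W cc X Y
      by (simp add: X_def[symmetric] Y_def[symmetric] right_add_zero_mat[OF cc(1)] left_add_zero_mat[OF cc(2)])
    finally have "W' = four_block_mat (adj U1 * W11 * V1 + X * 0\<^sub>m t2 t1) (adj U1 * W11 * 0\<^sub>m t1 t2 + X * 1\<^sub>m t2)
        (adj U2 * W21 * V1 + Y * 0\<^sub>m t2 t1) (adj U2 * W21 * 0\<^sub>m t1 t2 + Y * 1\<^sub>m t2)"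
      unfolding W'_def dsum_def carrier_matD[OF c(9)]
      by (simp add: mult_four_block_mat[OF cc(1) X cc(2) Y c(9), of "0\<^sub>m t1 t2" t2 "0\<^sub>m t2 t1" "1\<^sub>m t2"])
    also have "\<dots> = four_block_mat D11 X D21 Y"
      unfolding eq1 eq2 right_mult_zero_mat[OF cc(1)] right_mult_zero_mat[OF cc(2)]
        right_mult_zero_mat[OF X] right_mult_zero_mat[OF Y] right_mult_one_mat[OF X] right_mult_one_mat[OF Y]
      using D X Y by simp
    finally show ?thesis .
  qed
  have one: "1\<^sub>m n = four_block_mat (1\<^sub>m t1) (0\<^sub>m t1 t2) (0\<^sub>m t2 t1) (1\<^sub>m t2)" by (simp add: n)
  note Da = adj_carrier[OF D(1)] adj_carrier[OF D(2)] adj_carrier[OF D(3)] adj_carrier[OF D(4)]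
  note Xa = adj_carrier[OF X] and Ya = adj_carrier[OF Y]
  note ones = one_carrier_mat[of t1] zero_carrier_mat[of t1 t2] zero_carrier_mat[of t2 t1] one_carrier_mat[of t2]
  have "four_block_mat (adj D11 * D11 + adj D21 * D21) (adj D11 * X + adj D21 * Y)
      (adj X * D11 + adj Y * D21) (adj X * X + adj Y * Y)
    = four_block_mat (1\<^sub>m t1) (0\<^sub>m t1 t2) (0\<^sub>m t2 t1) (1\<^sub>m t2)"
    unfolding adj_four_block_mult[OF D(1) X D(3) Y D(1) X D(3) Y, symmetric] W'_eq[symmetric] one[symmetric]
    by (rule unitary_matD(3)[OF uW'])
  from four_block_mat_inject(2)[OF this
      add_mult_carrier[OF Da(1) D(1) Da(3) D(3)] add_mult_carrier[OF Da(1) X Da(3) Y]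
      add_mult_carrier[OF Xa D(1) Ya D(3)] add_mult_carrier[OF Xa X Ya Y] ones]
  have off: "adj D11 * X + adj D21 * Y = 0\<^sub>m t1 t2" .
  have "four_block_mat (adj D11 * D11 + adj D21 * D21) (adj D11 * D12 + adj D21 * D22)
      (adj D12 * D11 + adj D22 * D21) (adj D12 * D12 + adj D22 * D22)
    = four_block_mat (1\<^sub>m t1) (0\<^sub>m t1 t2) (0\<^sub>m t2 t1) (1\<^sub>m t2)"
    unfolding adj_four_block_mult[OF D D, symmetric] one[symmetric]
    by (rule unitary_matD(3)[OF uD])
  note DD = four_block_mat_inject(1,3)[OF this
      add_mult_carrier[OF Da(1) D(1) Da(3) D(3)] add_mult_carrier[OF Da(1) D(2) Da(3) D(4)]
      add_mult_carrier[OF Da(2) D(1) Da(4) D(3)] add_mult_carrier[OF Da(2) D(2) Da(4) D(4)] ones]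
  define Z where "Z = adj D12 * X + adj D22 * Y"
  have Z: "Z \<in> carrier_mat t2 t2" unfolding Z_def by (rule add_mult_carrier[OF Da(2) X Da(4) Y])
  have Z_eq: "adj ?D * W' = 1\<^sub>m t1 \<oplus>\<^sub>m Z"
    unfolding W'_eq adj_four_block_mult[OF D D(1) X D(3) Y] off DD Z_def[symmetric] dsum_def
    using Z by simp
  have uZ': "unitary_mat n (adj ?D * W')"
    by (intro unitary_mat_mult unitary_mat_adj uD uW')
  then have uZ: "unitary_mat t2 Z"
    unfolding Z_eq n by (rule unitary_mat_dsumD) (use Z in auto)
  show ?thesis
  proof (rule that[OF unitary_mat_adj[OF uZ]])
    have "V1 \<oplus>\<^sub>m adj Z = (V1 \<oplus>\<^sub>m 1\<^sub>m t2) * (1\<^sub>m t1 \<oplus>\<^sub>m adj Z)"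
      using c Z by (simp add: dsum_mult right_mult_one_mat[OF c(9)] left_mult_one_mat[OF adj_carrier[OF Z]])
    moreover have "1\<^sub>m t1 \<oplus>\<^sub>m adj Z = adj W' * ?D"
    proof -
      have "1\<^sub>m t1 \<oplus>\<^sub>m adj Z = adj (adj ?D * W')" unfolding Z_eq by (simp add: adj_dsum)
      then show ?thesis
        using adj_mult[OF unitary_matD(2)[OF uD] unitary_matD(1)[OF uW']] by simp
    qed
    moreover have "(adj U1 \<oplus>\<^sub>m adj U2) * ?W * ((V1 \<oplus>\<^sub>m 1\<^sub>m t2) * (adj W' * ?D)) = W' * (adj W' * ?D)"
      unfolding W'_def[symmetric]
    proof -
      have 1: "(adj U1 \<oplus>\<^sub>m adj U2) * ?W \<in> carrier_mat n n"
        by (rule mult_carrier_mat[of _ n n]) (use n' dsum_carrier[OF c(2,6)] unitary_matD(1)[OF uW] in auto)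
      have 2: "V1 \<oplus>\<^sub>m 1\<^sub>m t2 \<in> carrier_mat n n" using n dsum_carrier[OF c(9) one_carrier_mat[of t2]] by simp
      have 3: "adj W' * ?D \<in> carrier_mat n n"
        by (rule mult_carrier_mat[OF unitary_matD(2)[OF uW'] unitary_matD(1)[OF uD]])
      show "(adj U1 \<oplus>\<^sub>m adj U2) * ?W * ((V1 \<oplus>\<^sub>m 1\<^sub>m t2) * (adj W' * ?D)) = W' * (adj W' * ?D)"
        unfolding W'_def using assoc_mult_mat[OF 1 2 3] by (simp add: W'_def)
    qed
    ultimately show "(adj U1 \<oplus>\<^sub>m adj U2) * ?W * (V1 \<oplus>\<^sub>m adj Z) = ?D"
      using unitary_mult_cancel(2)[OF uW' unitary_matD(1)[OF uD]] by simp
  qed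
qed

text \<open>Apart from entries \<open>1\<close> and \<open>-1\<close> that are alone in their row and column, the matrix is composed of the
  reflections \<open>(1, \<sigma>\<epsilon>; \<sigma>\<epsilon>, -1)\<close>, \<open>(c, s; s, -c)\<close> or
  \<open>(d\<epsilon>, 1; 1, -d\<epsilon>)\<close>, whose columns are orthonormal since \<open>\<epsilon>\<^sup>2 = 0\<close> and \<open>c\<^sup>2 + s\<^sup>2 = 1\<close>.\<close>

lemma cs_form_unitary:
  fixes c s :: "nat \<Rightarrow> real dual" and \<sigma> d :: "nat \<Rightarrow> real" and r p p' l t q q' :: nat
  assumes cs: "dq_diag l c * dq_diag l c + dq_diag l s * dq_diag l s = 1\<^sub>m l"
  defines "D11 \<equiv> 1\<^sub>m r \<oplus>\<^sub>m 1\<^sub>m p \<oplus>\<^sub>m dq_diag l c \<oplus>\<^sub>m dq_diag_eps t d \<oplus>\<^sub>m 0\<^sub>m q q'"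
    and "D12 \<equiv> dq_diag_eps r \<sigma> \<oplus>\<^sub>m 0\<^sub>m p p' \<oplus>\<^sub>m dq_diag l s \<oplus>\<^sub>m 1\<^sub>m t \<oplus>\<^sub>m 1\<^sub>m q"
    and "D21 \<equiv> dq_diag_eps r \<sigma> \<oplus>\<^sub>m 0\<^sub>m p' p \<oplus>\<^sub>m dq_diag l s \<oplus>\<^sub>m 1\<^sub>m t \<oplus>\<^sub>m 1\<^sub>m q'"
    and "D22 \<equiv> - 1\<^sub>m r \<oplus>\<^sub>m - 1\<^sub>m p' \<oplus>\<^sub>m - dq_diag l c \<oplus>\<^sub>m - dq_diag_eps t d \<oplus>\<^sub>m 0\<^sub>m q' q"
  shows "unitary_mat (r + (p + (l + (t + q'))) + (r + (p' + (l + (t + q))))) (four_block_mat D11 D12 D21 D22)"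
    (is "unitary_mat ?n _")
proof -
  define r1 r2 t1 t2 where "r1 = r + (p + (l + (t + q)))" and "r2 = r + (p' + (l + (t + q')))"
    and "t1 = r + (p + (l + (t + q')))" and "t2 = r + (p' + (l + (t + q)))"
  have D: "D11 \<in> carrier_mat r1 t1" "D12 \<in> carrier_mat r1 t2" "D21 \<in> carrier_mat r2 t1" "D22 \<in> carrier_mat r2 t2"
    unfolding r1_def r2_def t1_def t2_def D11_def D12_def D21_def D22_def by (auto intro!: dsum_carrier)
  have sc: "dq_diag l s * dq_diag l s + dq_diag l c * dq_diag l c = 1\<^sub>m l"
    unfolding cs[symmetric] dq_diag_mult by (rule comm_add_mat) auto
  have sc': "dq_diag l s * dq_diag l c = dq_diag l c * dq_diag l s"
    by (simp add: dq_diag_mult mult.commute)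
  have adj_neg: "adj (- A) = - adj A" for A :: "dual_quat mat"
    by (rule eq_matI) (auto simp: star_minus)
  have D11a: "adj D11 = 1\<^sub>m r \<oplus>\<^sub>m 1\<^sub>m p \<oplus>\<^sub>m dq_diag l c \<oplus>\<^sub>m dq_diag_eps t d \<oplus>\<^sub>m 0\<^sub>m q' q"
    by (simp add: D11_def adj_dsum adj_dq_diag adj_dq_diag_eps)
  have D12a: "adj D12 = dq_diag_eps r \<sigma> \<oplus>\<^sub>m 0\<^sub>m p' p \<oplus>\<^sub>m dq_diag l s \<oplus>\<^sub>m 1\<^sub>m t \<oplus>\<^sub>m 1\<^sub>m q"
    by (simp add: D12_def adj_dsum adj_dq_diag adj_dq_diag_eps)
  have D21a: "adj D21 = dq_diag_eps r \<sigma> \<oplus>\<^sub>m 0\<^sub>m p p' \<oplus>\<^sub>m dq_diag l s \<oplus>\<^sub>m 1\<^sub>m t \<oplus>\<^sub>m 1\<^sub>m q'"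
    by (simp add: D21_def adj_dsum adj_dq_diag adj_dq_diag_eps)
  have D22a: "adj D22 = - 1\<^sub>m r \<oplus>\<^sub>m - 1\<^sub>m p' \<oplus>\<^sub>m - dq_diag l c \<oplus>\<^sub>m - dq_diag_eps t d \<oplus>\<^sub>m 0\<^sub>m q q'"
    by (simp add: D22_def adj_dsum adj_dq_diag adj_dq_diag_eps adj_neg)
  have neg_neg: "(- A) * (- B) = A * B" if "A \<in> carrier_mat m n" "B \<in> carrier_mat n k"
    for A B :: "dual_quat mat" and m n k
    using that by (intro eq_matI) (auto simp: scalar_prod_def)
  have neg_inv: "A + - A = 0\<^sub>m (dim_row A) (dim_col A)" "- A + A = 0\<^sub>m (dim_row A) (dim_col A)"
    for A :: "dual_quat mat"
    by (rule eq_matI; simp)+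
  have neg_zero: "- 0\<^sub>m i j = (0\<^sub>m i j :: dual_quat mat)" for i j
    by (rule eq_matI) auto
  have "adj D11 * D11 + adj D21 * D21 = 1\<^sub>m t1"
    unfolding D11a D21a unfolding D11_def D21_def
    by (simp add: dsum_mult dsum_add cs dq_diag_eps_mult)
       (simp add: dsum_one t1_def)
  moreover have "adj D12 * D12 + adj D22 * D22 = 1\<^sub>m t2"
    unfolding D12a D22a unfolding D12_def D22_def
    by (simp add: dsum_mult dsum_add sc dq_diag_eps_mult neg_neg)
       (simp add: dsum_one t2_def)
  moreover have "adj D11 * D12 + adj D21 * D22 = 0\<^sub>m t1 t2"
    unfolding D11a D21a unfolding D12_def D22_def
    by (simp add: dsum_mult dsum_add sc' dq_diag_eps_mult neg_inv neg_zero)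
       (simp add: dsum_zero t1_def t2_def)
  moreover have "adj D12 * D11 + adj D22 * D21 = 0\<^sub>m t2 t1"
    unfolding D12a D22a unfolding D11_def D21_def
    by (simp add: dsum_mult dsum_add sc' dq_diag_eps_mult neg_inv neg_zero)
       (simp add: dsum_zero t1_def t2_def)
  ultimately have "adj (four_block_mat D11 D12 D21 D22) * four_block_mat D11 D12 D21 D22 = 1\<^sub>m (t1 + t2)"
    unfolding adj_four_block_mult[OF D D] by simp
  moreover have "r1 + r2 = t1 + t2" "?n = t1 + t2" by (simp_all add: r1_def r2_def t1_def t2_def)
  ultimately show ?thesis
    using four_block_carrier_mat[OF D(1,4)] by (intro square_isometry_unitary) simp_all
qed

section \<open>The CS decomposition of unitary dual quaternion matrices\<close>

theorem theorem3p2: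
  fixes W W11 W12 W21 W22 :: "dual_quat mat" and n r1 r2 t1 t2 :: nat
  assumes "W \<in> carrier_mat n n"
    and "dq_unitary W"
    and "W11 \<in> carrier_mat r1 t1"
    and "W12 \<in> carrier_mat r1 t2"
    and "W21 \<in> carrier_mat r2 t1"
    and "W22 \<in> carrier_mat r2 t2"
    and "W = four_block_mat W11 W12 W21 W22"
  shows "\<exists>U1 \<in> carrier_mat r1 r1. \<exists>U2 \<in> carrier_mat r2 r2.
         \<exists>V1 \<in> carrier_mat t1 t1. \<exists>V2 \<in> carrier_mat t2 t2.
         \<exists>D11 \<in> carrier_mat r1 t1. \<exists>D12 \<in> carrier_mat r1 t2.
         \<exists>D21 \<in> carrier_mat r2 t1. \<exists>D22 \<in> carrier_mat r2 t2.
         \<exists>(r::nat) (p::nat) (p'::nat) (l::nat) (t::nat) (q::nat) (q'::nat)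
          (\<sigma> :: nat \<Rightarrow> real) (d :: nat \<Rightarrow> real)
          (c :: nat \<Rightarrow> real dual) (s :: nat \<Rightarrow> real dual).
           dq_unitary U1 \<and> dq_unitary U2 \<and> dq_unitary V1 \<and> dq_unitary V2 \<and>
           block_diag2 (dq_adjoint U1) (dq_adjoint U2) * W * block_diag2 V1 V2
             = four_block_mat D11 D12 D21 D22 \<and>
           D11 = diag_block_mat
             [1\<^sub>m r, 1\<^sub>m p, dq_diag l c, dq_diag_eps t d, 0\<^sub>m q q'] \<and>
           D12 = diag_block_mat
             [dq_diag_eps r \<sigma>, 0\<^sub>m p p', dq_diag l s, 1\<^sub>m t, 1\<^sub>m q] \<and>
           D21 = diag_block_mat
             [dq_diag_eps r \<sigma>, 0\<^sub>m p' p, dq_diag l s, 1\<^sub>m t, 1\<^sub>m q'] \<and>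
           D22 = diag_block_mat
             [- 1\<^sub>m r, - 1\<^sub>m p', - dq_diag l c, - dq_diag_eps t d, 0\<^sub>m q' q] \<and>
           (\<forall>i<r. 0 < \<sigma> i) \<and> (\<forall>j<r. \<forall>i\<le>j. \<sigma> j \<le> \<sigma> i) \<and>
           (\<forall>i<t. 0 < d i) \<and> (\<forall>j<t. \<forall>i\<le>j. d j \<le> d i) \<and>
           (\<forall>i<l. appreciable (c i) \<and> 0 < c i \<and> c i < 1) \<and>
           (\<forall>j<l. \<forall>i\<le>j. c j \<le> c i) \<and>
           (\<forall>i<l. appreciable (s i) \<and> 0 < s i \<and> s i < 1) \<and>
           (\<forall>j<l. \<forall>i\<le>j. s i \<le> s j) \<and>
           dq_diag l c * dq_diag l c + dq_diag l s * dq_diag l s = 1\<^sub>m l"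
proof -
  note W = assms(3-6)
  note Wa = adj_carrier[OF W(1)] adj_carrier[OF W(2)] adj_carrier[OF W(3)] adj_carrier[OF W(4)]
  have uW: "unitary_mat n (four_block_mat W11 W12 W21 W22)"
    using assms(1,2) unfolding assms(7)[symmetric] by (simp add: dq_unitary_iff)
  have n: "n = r1 + r2" "n = t1 + t2" using assms(1) W unfolding assms(7) by auto
  have "four_block_mat (adj W11 * W11 + adj W21 * W21) (adj W11 * W12 + adj W21 * W22)
      (adj W12 * W11 + adj W22 * W21) (adj W12 * W12 + adj W22 * W22)
    = four_block_mat (1\<^sub>m t1) (0\<^sub>m t1 t2) (0\<^sub>m t2 t1) (1\<^sub>m t2)"
    unfolding adj_four_block_mult[OF W W, symmetric] using unitary_matD(3)[OF uW] by (simp add: n(2))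
  from four_block_mat_inject(1)[OF this
      add_mult_carrier[OF Wa(1) W(1) Wa(3) W(3)] add_mult_carrier[OF Wa(1) W(2) Wa(3) W(4)]
      add_mult_carrier[OF Wa(2) W(1) Wa(4) W(3)] add_mult_carrier[OF Wa(2) W(2) Wa(4) W(4)]
      one_carrier_mat zero_carrier_mat zero_carrier_mat one_carrier_mat]
  have WW: "adj W11 * W11 + adj W21 * W21 = 1\<^sub>m t1" .
  define H where "H = adj W11 * W11"
  have H: "H \<in> carrier_mat t1 t1" unfolding H_def by (rule mult_carrier_mat[OF Wa(1) W(1)])
  have "adj H = H" unfolding H_def using adj_mult[OF Wa(1) W(1)] by simp
  then obtain V0 f where V0: "unitary_mat t1 V0" and H_diag: "adj V0 * H * V0 = dq_diag t1 f"
    and mono: "\<And>i j. i \<le> j \<Longrightarrow> j < t1 \<Longrightarrow> f j \<le> f i"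
    using dual_quat_hermitian_diagonalisation[OF H] by blast
  note V0c = unitary_matD[OF V0]
  have gram: "adj (A * V0) * (A * V0) = adj V0 * (adj A * A) * V0" if A: "A \<in> carrier_mat m t1"
    for A :: "dual_quat mat" and m
  proof -
    have Aa: "adj A \<in> carrier_mat t1 m" using A by auto
    have "adj (A * V0) * (A * V0) = adj V0 * adj A * (A * V0)"
      unfolding adj_mult[OF A V0c(1)] ..
    also have "\<dots> = adj V0 * adj A * A * V0"
      by (rule assoc_mult_mat[symmetric, OF mult_carrier_mat[OF V0c(2) Aa] A V0c(1)])
    also have "adj V0 * adj A * A = adj V0 * (adj A * A)"
      by (rule assoc_mult_mat[OF V0c(2) Aa A])
    finally show ?thesis .
  qed
  define M N where "M = W11 * V0" and "N = W21 * V0"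
  have M: "M \<in> carrier_mat r1 t1" and N: "N \<in> carrier_mat r2 t1"
    unfolding M_def N_def by (rule mult_carrier_mat[OF W(1) V0c(1)], rule mult_carrier_mat[OF W(3) V0c(1)])
  have gram_M: "adj M * M = dq_diag t1 f"
    unfolding M_def gram[OF W(1)] using H_diag by (simp add: H_def)
  have gram_N: "adj N * N = dq_diag t1 (\<lambda>i. 1 - f i)"
  proof -
    have W2: "adj W21 * W21 \<in> carrier_mat t1 t1" by (rule mult_carrier_mat[OF Wa(3) W(3)])
    have "adj W21 * W21 = 1\<^sub>m t1 - H"
      unfolding WW[symmetric] H_def[symmetric] by (rule eq_matI) (use W2 H in auto)
    then have "adj N * N = adj V0 * (1\<^sub>m t1 - H) * V0"
      unfolding N_def gram[OF W(3)] by simp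
    also have "\<dots> = adj V0 * 1\<^sub>m t1 * V0 - adj V0 * H * V0"
      unfolding mult_minus_distrib_mat[OF V0c(2) one_carrier_mat H]
      by (rule minus_mult_distrib_mat[OF mult_carrier_mat[OF V0c(2) one_carrier_mat]
            mult_carrier_mat[OF V0c(2) H] V0c(1)])
    also have "\<dots> = 1\<^sub>m t1 - dq_diag t1 f"
      unfolding right_mult_one_mat[OF V0c(2)] V0c(3) H_diag ..
    finally show ?thesis by (simp add: dq_diag_minus)
  qed
  obtain U1 U2 V r p p' l t q q' \<sigma> d c s where
    U1: "unitary_mat r1 U1" and U2: "unitary_mat r2 U2" and V: "unitary_mat t1 V"
    and r1: "r1 = r + (p + (l + (t + q)))" and r2: "r2 = r + (p' + (l + (t + q')))"
    and t1: "t1 = r + (p + (l + (t + q')))"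
    and eq1: "adj U1 * M * V = 1\<^sub>m r \<oplus>\<^sub>m 1\<^sub>m p \<oplus>\<^sub>m dq_diag l c \<oplus>\<^sub>m dq_diag_eps t d \<oplus>\<^sub>m 0\<^sub>m q q'"
    and eq2: "adj U2 * N * V = dq_diag_eps r \<sigma> \<oplus>\<^sub>m 0\<^sub>m p' p \<oplus>\<^sub>m dq_diag l s \<oplus>\<^sub>m 1\<^sub>m t \<oplus>\<^sub>m 1\<^sub>m q'"
    and params: "\<forall>i<r. 0 < \<sigma> i" "\<forall>j<r. \<forall>i\<le>j. \<sigma> j \<le> \<sigma> i"
    "\<forall>i<t. 0 < d i" "\<forall>j<t. \<forall>i\<le>j. d j \<le> d i"
    "\<forall>i<l. appreciable (c i) \<and> 0 < c i \<and> c i < 1" "\<forall>j<l. \<forall>i\<le>j. c j \<le> c i"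
    "\<forall>i<l. appreciable (s i) \<and> 0 < s i \<and> s i < 1" "\<forall>j<l. \<forall>i\<le>j. s i \<le> s j"
    "dq_diag l c * dq_diag l c + dq_diag l s * dq_diag l s = 1\<^sub>m l"
    by (rule block_column_decomposition[OF M N gram_M gram_N mono])
  have t2: "t2 = r + (p' + (l + (t + q)))" using n r1 r2 t1 by simp
  define D11 where "D11 = 1\<^sub>m r \<oplus>\<^sub>m 1\<^sub>m p \<oplus>\<^sub>m dq_diag l c \<oplus>\<^sub>m dq_diag_eps t d \<oplus>\<^sub>m 0\<^sub>m q q'"
  define D12 where "D12 = dq_diag_eps r \<sigma> \<oplus>\<^sub>m 0\<^sub>m p p' \<oplus>\<^sub>m dq_diag l s \<oplus>\<^sub>m 1\<^sub>m t \<oplus>\<^sub>m 1\<^sub>m q"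
  define D21 where "D21 = dq_diag_eps r \<sigma> \<oplus>\<^sub>m 0\<^sub>m p' p \<oplus>\<^sub>m dq_diag l s \<oplus>\<^sub>m 1\<^sub>m t \<oplus>\<^sub>m 1\<^sub>m q'"
  define D22 where "D22 = - 1\<^sub>m r \<oplus>\<^sub>m - 1\<^sub>m p' \<oplus>\<^sub>m - dq_diag l c \<oplus>\<^sub>m - dq_diag_eps t d \<oplus>\<^sub>m 0\<^sub>m q' q"
  have D: "D11 \<in> carrier_mat r1 t1" "D12 \<in> carrier_mat r1 t2" "D21 \<in> carrier_mat r2 t1" "D22 \<in> carrier_mat r2 t2"
    unfolding r1 r2 t1 t2 D11_def D12_def D21_def D22_def by (auto intro!: dsum_carrier)
  have uD: "unitary_mat n (four_block_mat D11 D12 D21 D22)"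
    using cs_form_unitary[OF params(9), where r = r and p = p and t = t and d = d and q = q and q' = q'
        and \<sigma> = \<sigma> and p' = p']
    unfolding D11_def D12_def D21_def D22_def n(2) t1 t2 .
  define V1 where "V1 = V0 * V"
  have V1: "unitary_mat t1 V1" unfolding V1_def by (rule unitary_mat_mult[OF V0 V])
  have assoc: "adj U * A * (V0 * V) = adj U * (A * V0) * V"
    if "A \<in> carrier_mat m t1" "U \<in> carrier_mat m m" for A U :: "dual_quat mat" and m
    using assoc_mult_mat[OF adj_carrier[OF that(2)] that(1) V0c(1)]
      assoc_mult_mat[OF mult_carrier_mat[OF adj_carrier[OF that(2)] that(1)] V0c(1) unitary_matD(1)[OF V]]
    by simp
  have eq1': "adj U1 * W11 * V1 = D11" and eq2': "adj U2 * W21 * V1 = D21"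
    unfolding V1_def assoc[OF W(1) unitary_matD(1)[OF U1]] assoc[OF W(3) unitary_matD(1)[OF U2]]
    using eq1 eq2 by (simp_all add: M_def N_def D11_def D21_def)
  obtain V2 where V2: "unitary_mat t2 V2"
    and eq: "(adj U1 \<oplus>\<^sub>m adj U2) * four_block_mat W11 W12 W21 W22 * (V1 \<oplus>\<^sub>m V2)
      = four_block_mat D11 D12 D21 D22"
    by (rule unitary_complete_block_column[OF W D uW uD n(2) U1 U2 V1 eq1' eq2'])
  have blocks: "D11 = diag_block_mat [1\<^sub>m r, 1\<^sub>m p, dq_diag l c, dq_diag_eps t d, 0\<^sub>m q q']"
    "D12 = diag_block_mat [dq_diag_eps r \<sigma>, 0\<^sub>m p p', dq_diag l s, 1\<^sub>m t, 1\<^sub>m q]"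
    "D21 = diag_block_mat [dq_diag_eps r \<sigma>, 0\<^sub>m p' p, dq_diag l s, 1\<^sub>m t, 1\<^sub>m q']"
    "D22 = diag_block_mat [- 1\<^sub>m r, - 1\<^sub>m p', - dq_diag l c, - dq_diag_eps t d, 0\<^sub>m q' q]"
    unfolding D11_def D12_def D21_def D22_def diag_block_mat_Cons_dsum by simp_all
  note UV = unitary_matD(1)[OF U1] unitary_matD(1)[OF U2] unitary_matD(1)[OF V1] unitary_matD(1)[OF V2]
  have uni: "dq_unitary U1" "dq_unitary U2" "dq_unitary V1" "dq_unitary V2"
    using U1 U2 V1 V2 dq_unitary_iff[OF UV(1)] dq_unitary_iff[OF UV(2)] dq_unitary_iff[OF UV(3)]
      dq_unitary_iff[OF UV(4)] by auto
  have prod: "block_diag2 (dq_adjoint U1) (dq_adjoint U2) * W * block_diag2 V1 V2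
      = four_block_mat D11 D12 D21 D22"
    unfolding block_diag2_eq_dsum dq_adjoint_eq_adj assms(7) by (rule eq)
  show ?thesis
    by (rule bexI[OF _ UV(1)], rule bexI[OF _ UV(2)], rule bexI[OF _ UV(3)], rule bexI[OF _ UV(4)],
        rule bexI[OF _ D(1)], rule bexI[OF _ D(2)], rule bexI[OF _ D(3)], rule bexI[OF _ D(4)],
        rule exI[of _ r], rule exI[of _ p], rule exI[of _ p'], rule exI[of _ l], rule exI[of _ t],
        rule exI[of _ q], rule exI[of _ q'], rule exI[of _ \<sigma>], rule exI[of _ d], rule exI[of _ c],
        rule exI[of _ s], intro conjI uni prod blocks params)
qed

end
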